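(* Let $L\ge 2$ and let $H=-\sum_T G(T)$, the sum running over all triangles $T$ of the $L\times L$ periodic square lattice, where $G(T)$ are the three-qubit triangle operators defined in the context. Then the set of eigenvalues of $H$ is $$\Big\{\sum_p \sigma_p\,\epsilon(x_p,z_p)\Big\},\qquad \epsilon(x,z)=\sqrt{(1+x)^2+(1+z)^2},$$ where $p$ runs over the plaquettes, $\sigma_p,x_p,z_p$ range over all choices in $\{1,-1\}$ subject to $\prod_p x_p=\prod_p z_p=1$ (here $x_p,z_p$ are the eigenvalues of $S^X_p,S^Z_p$, and $\epsilon(1,1)=2\sqrt2$, $\epsilon(1,-1)=\epsilon(-1,1)=2$, $\epsilon(-1,-1)=0$). The ground state energy of $H$ is $-2\sqrt2\,L^2$, the ground states lie in the sector $x_p=z_p=1$ for all $p$, the ground state is exactly four-fold degenerate, and the energy gap between the ground state energy and the next eigenvalue is $4(\sqrt2-1)$, independently of $L$.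
   Context: Lattice: the square lattice of size $L\times L$ with periodic boundary conditions. One qubit sits at every vertex and one at the centre of every edge ($3L^2$ qubits in total). Triangles: a triangle is a triple $T=(u,f,g)$ where $u$ is a vertex and $f,g$ are two orthogonal edges incident to $u$; it belongs to the plaquette having both $f$ and $g$ on its boundary. $T$ is called SW, SE, NW or NE if $u$ is the south-west, south-east, north-west or north-east corner of that plaquette. Write $T^{SW}_p$, etc., for the triangles of plaquette $p$. Triangle operators: $G(T)=X_uX_fX_g$ if $T$ is SW or NE, and $G(T)=Z_uZ_fZ_g$ if $T$ is SE or NW, with $X_j,Z_j$ the Pauli operators on qubit $j$. Stabilizers: $S^X_p=G(T^{SW}_p)G(T^{NE}_p)$ and $S^Z_p=G(T^{SE}_p)G(T^{NW}_p)$ for each plaquette $p$; they commute with every triangle operator and with each other. *)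

theory Defs
  imports Complex_Main "HOL-Library.FuncSet" "HOL-Library.Function_Algebras"
begin

section \<open>The periodic square lattice\<close>

text \<open>
  Sites are pairs of coordinates modulo \<open>L\<close> (first coordinate growing eastwards, second
  northwards).  A site \<open>s\<close> labels the vertex at \<open>s\<close>, the horizontal edge leaving \<open>s\<close> to the east,
  the vertical edge leaving \<open>s\<close> to the north, and the plaquette whose south-west corner is \<open>s\<close>.
\<close>

type_synonym site = "nat \<times> nat"

datatype qubit = Vertex site | HEdge site | VEdge site

definition sites :: "nat \<Rightarrow> site set" where
  "sites L = {..<L} \<times> {..<L}"

abbreviation plaquettes :: "nat \<Rightarrow> site set" where
  "plaquettes \<equiv> sites"

definition qubits :: "nat \<Rightarrow> qubit set" where
  "qubits L = Vertex ` sites L \<union> HEdge ` sites L \<union> VEdge ` sites L"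

fun east :: "nat \<Rightarrow> site \<Rightarrow> site" where
  "east L (i, j) = (Suc i mod L, j)"

fun north :: "nat \<Rightarrow> site \<Rightarrow> site" where
  "north L (i, j) = (i, Suc j mod L)"

fun endpoints :: "nat \<Rightarrow> qubit \<Rightarrow> qubit set" where
  "endpoints L (Vertex s) = {}"
| "endpoints L (HEdge s) = {Vertex s, Vertex (east L s)}"
| "endpoints L (VEdge s) = {Vertex s, Vertex (north L s)}"

definition boundary :: "nat \<Rightarrow> site \<Rightarrow> qubit set" where
  "boundary L p = {HEdge p, HEdge (north L p), VEdge p, VEdge (east L p)}"


section \<open>Triangles\<close>

type_synonym triangle = "qubit \<times> qubit \<times> qubit"

text \<open>
  The two edges of a triangle form an unordered pair of orthogonal edges; the horizontal one is
  listed first, so that every triangle occurs exactly once.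
\<close>

definition triangles :: "nat \<Rightarrow> triangle set" where
  "triangles L = {(u, f, g). u \<in> Vertex ` sites L \<and> f \<in> HEdge ` sites L \<and> g \<in> VEdge ` sites L
     \<and> u \<in> endpoints L f \<and> u \<in> endpoints L g}"

datatype corner = SW | SE | NW | NE

fun corner_vertex :: "nat \<Rightarrow> corner \<Rightarrow> site \<Rightarrow> qubit" where
  "corner_vertex L SW p = Vertex p"
| "corner_vertex L SE p = Vertex (east L p)"
| "corner_vertex L NW p = Vertex (north L p)"
| "corner_vertex L NE p = Vertex (north L (east L p))"

fun at_corner :: "nat \<Rightarrow> corner \<Rightarrow> site \<Rightarrow> triangle \<Rightarrow> bool" where
  "at_corner L c p (u, f, g) \<longleftrightarrow> f \<in> boundary L p \<and> g \<in> boundary L p \<and> u = corner_vertex L c p"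

definition has_type :: "nat \<Rightarrow> corner \<Rightarrow> triangle \<Rightarrow> bool" where
  "has_type L c T \<longleftrightarrow> (\<exists>p\<in>plaquettes L. at_corner L c p T)"

fun triangle_of :: "nat \<Rightarrow> corner \<Rightarrow> site \<Rightarrow> triangle" where
  "triangle_of L SW p = (Vertex p, HEdge p, VEdge p)"
| "triangle_of L SE p = (Vertex (east L p), HEdge p, VEdge (east L p))"
| "triangle_of L NW p = (Vertex (north L p), HEdge (north L p), VEdge p)"
| "triangle_of L NE p = (Vertex (north L (east L p)), HEdge (north L p), VEdge (east L p))"

lemma Suc_mod_neq: "2 \<le> L \<Longrightarrow> i < L \<Longrightarrow> Suc i mod L \<noteq> i"
  by (cases "Suc i = L") auto

lemma Suc_mod_inj: "i < L \<Longrightarrow> j < L \<Longrightarrow> Suc i mod L = Suc j mod L \<longleftrightarrow> i = j"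
  by (cases "Suc i = L"; cases "Suc j = L") auto

lemma triangle_of_correct:
  assumes "2 \<le> L" "p \<in> plaquettes L"
  shows "T \<in> triangles L \<and> at_corner L c p T \<longleftrightarrow> T = triangle_of L c p"
proof -
  obtain i j where p: "p = (i, j)" "i < L" "j < L"
    using assms(2) by (auto simp: sites_def)
  have neq: "Suc i mod L \<noteq> i" "Suc j mod L \<noteq> j" "i \<noteq> Suc i mod L" "j \<noteq> Suc j mod L"
    and neq2: "Suc (Suc i mod L) mod L \<noteq> Suc i mod L" "Suc (Suc j mod L) mod L \<noteq> Suc j mod L"
    using assms(1) p by (metis Suc_mod_neq mod_less_divisor less_le_trans pos2)+
  have less: "0 < L"
    using assms(1) by simp
  show ?thesis
    using neq neq2 less p
    by (cases c; cases T; auto simp: triangles_def boundary_def sites_def)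
qed

lemma bij_betw_triangle_of:
  assumes "2 \<le> L"
  shows "bij_betw (\<lambda>(c, p). triangle_of L c p) (UNIV \<times> plaquettes L) (triangles L)"
  unfolding bij_betw_def
proof (intro conjI subset_antisym subsetI)
  show "inj_on (\<lambda>(c, p). triangle_of L c p) (UNIV \<times> plaquettes L)"
  proof (rule inj_onI, clarify)
    fix c i j c' i' j'
    assume "(i, j) \<in> plaquettes L" "(i', j') \<in> plaquettes L"
      and "triangle_of L c (i, j) = triangle_of L c' (i', j')"
    then show "c = c' \<and> (i, j) = (i', j')"
      using assms
      by (cases c; cases c')
         (auto simp: sites_def Suc_mod_inj Suc_mod_neq Suc_mod_neq[symmetric])
  qed
next
  fix T assume "T \<in> (\<lambda>(c, p). triangle_of L c p) ` (UNIV \<times> plaquettes L)"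
  then obtain c p where "p \<in> plaquettes L" "T = triangle_of L c p"
    by auto
  then show "T \<in> triangles L"
    using triangle_of_correct[OF assms, of p T c] by blast
next
  fix T assume T: "T \<in> triangles L"
  then obtain i j i' j' where ab: "i < L" "j < L" "i' < L" "j' < L"
    and fg: "fst (snd T) = HEdge (i, j)" "snd (snd T) = VEdge (i', j')"
    by (auto simp: triangles_def sites_def)
  have "\<exists>c p. p \<in> plaquettes L \<and> T = triangle_of L c p"
  proof -
    from T fg have
      "(fst T = Vertex (i, j) \<or> fst T = Vertex (Suc i mod L, j)) \<and>
       (fst T = Vertex (i', j') \<or> fst T = Vertex (i', Suc j' mod L))"
      by (auto simp: triangles_def)
    then consider
        "T = triangle_of L SW (i, j)" | "T = triangle_of L SE (i, j)"
      | "T = triangle_of L NW (i', j')" | "T = triangle_of L NE (i, j')"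
      using fg by (cases T) auto
    then show ?thesis
    proof cases
      case 1
      have "(i, j) \<in> plaquettes L" using ab by (simp add: sites_def)
      with 1 show ?thesis by blast
    next
      case 2
      have "(i, j) \<in> plaquettes L" using ab by (simp add: sites_def)
      with 2 show ?thesis by blast
    next
      case 3
      have "(i', j') \<in> plaquettes L" using ab by (simp add: sites_def)
      with 3 show ?thesis by blast
    next
      case 4
      have "(i, j') \<in> plaquettes L" using ab by (simp add: sites_def)
      with 4 show ?thesis by blast
    qed
  qed
  then show "T \<in> (\<lambda>(c, p). triangle_of L c p) ` (UNIV \<times> plaquettes L)"
    by force
qed


section \<open>Qubit states and operators\<close>

text \<open>
  A basis state of the qubits is given by the set of qubits that are in state \<open>|1>\<close>.  A vector
  assigns an amplitude to every such set, and the Hilbert space of the lattice consists of the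
  vectors supported on the subsets of \<open>qubits L\<close>.
\<close>

type_synonym state = "qubit set \<Rightarrow> complex"

definition cscale :: "complex \<Rightarrow> state \<Rightarrow> state" where
  "cscale c \<psi> = (\<lambda>A. c * \<psi> A)"

interpretation qstate: vector_space cscale
  by unfold_locales (auto simp: cscale_def fun_eq_iff algebra_simps)

definition hilbert :: "nat \<Rightarrow> state set" where
  "hilbert L = {\<psi>. \<forall>A. \<not> A \<subseteq> qubits L \<longrightarrow> \<psi> A = 0}"

definition pauli_X :: "qubit \<Rightarrow> state \<Rightarrow> state" where
  "pauli_X q \<psi> = (\<lambda>A. \<psi> (if q \<in> A then A - {q} else insert q A))"

definition pauli_Z :: "qubit \<Rightarrow> state \<Rightarrow> state" where
  "pauli_Z q \<psi> = (\<lambda>A. if q \<in> A then - \<psi> A else \<psi> A)"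

fun G :: "nat \<Rightarrow> triangle \<Rightarrow> state \<Rightarrow> state" where
  "G L (u, f, g) =
     (if has_type L SW (u, f, g) \<or> has_type L NE (u, f, g)
      then pauli_X u \<circ> pauli_X f \<circ> pauli_X g
      else pauli_Z u \<circ> pauli_Z f \<circ> pauli_Z g)"

definition stab_X :: "nat \<Rightarrow> site \<Rightarrow> state \<Rightarrow> state" where
  "stab_X L p = G L (triangle_of L SW p) \<circ> G L (triangle_of L NE p)"

definition stab_Z :: "nat \<Rightarrow> site \<Rightarrow> state \<Rightarrow> state" where
  "stab_Z L p = G L (triangle_of L SE p) \<circ> G L (triangle_of L NW p)"

definition hamiltonian :: "nat \<Rightarrow> state \<Rightarrow> state" where
  "hamiltonian L \<psi> = - (\<Sum>T\<in>triangles L. G L T \<psi>)"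


section \<open>Spectral notions\<close>

definition eigenspace :: "state set \<Rightarrow> (state \<Rightarrow> state) \<Rightarrow> complex \<Rightarrow> state set" where
  "eigenspace V F \<mu> = {\<psi> \<in> V. F \<psi> = cscale \<mu> \<psi>}"

definition eigenvalues :: "state set \<Rightarrow> (state \<Rightarrow> state) \<Rightarrow> complex set" where
  "eigenvalues V F = {\<mu>. \<exists>\<psi>\<in>eigenspace V F \<mu>. \<psi> \<noteq> 0}"

definition sector :: "nat \<Rightarrow> (site \<Rightarrow> real) \<Rightarrow> (site \<Rightarrow> real) \<Rightarrow> state set" where
  "sector L x z = {\<psi> \<in> hilbert L. \<forall>p\<in>plaquettes L.
     stab_X L p \<psi> = cscale (of_real (x p)) \<psi> \<and> stab_Z L p \<psi> = cscale (of_real (z p)) \<psi>}"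

text \<open>
  The spectrum is finite, nonempty and real (for \<open>L \<ge> 2\<close>), so that the minima below are over
  finite nonempty sets of reals and no eigenvalue is lost.
\<close>

definition energies :: "nat \<Rightarrow> real set" where
  "energies L = {E. complex_of_real E \<in> eigenvalues (hilbert L) (hamiltonian L)}"

definition ground_energy :: "nat \<Rightarrow> real" where
  "ground_energy L = Min (energies L)"

definition energy_gap :: "nat \<Rightarrow> real" where
  "energy_gap L = Min (energies L - {ground_energy L}) - ground_energy L"

definition ground_space :: "nat \<Rightarrow> state set" where
  "ground_space L = eigenspace (hilbert L) (hamiltonian L) (of_real (ground_energy L))"

definition \<epsilon> :: "real \<Rightarrow> real \<Rightarrow> real" where
  "\<epsilon> x z = sqrt ((1 + x)\<^sup>2 + (1 + z)\<^sup>2)"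

definition signs :: "nat \<Rightarrow> (site \<Rightarrow> real) set" where
  "signs L = plaquettes L \<rightarrow> {1, - 1}"

definition syndromes :: "nat \<Rightarrow> (site \<Rightarrow> real) set" where
  "syndromes L = {x \<in> signs L. (\<Prod>p\<in>plaquettes L. x p) = 1}"

end

theory Submission
  imports Defs
begin

text \<open>
  Within a plaquette the two X triangles commute, the two Z triangles commute, and every X triangle
  anticommutes with every Z triangle; triangles of different plaquettes commute.  In the sector
  \<open>(x, z)\<close> the energy of a plaquette is therefore \<open>- ((1 + x) A + (1 + z) B) = - \<epsilon>(x, z) W\<close>, where
  \<open>A\<close> and \<open>B\<close> are its south-west and south-east triangle operators and \<open>W\<close> is an involution.  The
  stabilizers and the operators \<open>W\<close> form a commuting family of involutions.  The product of the
  south-west triangles over all plaquettes is the X string on all qubits, and so is the product of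
  the north-east ones, whence \<open>\<Prod>p. x p = 1\<close> (likewise for \<open>z\<close>).  Apart from these two relations,
  each generator can be flipped by an operator that commutes with all the others, so each of the
  \<open>3L\<^sup>2 - 2\<close> independent generators halves the dimension \<open>2^(3L\<^sup>2)\<close>: every admissible choice of
  eigenvalues has a joint eigenspace of dimension \<open>4\<close>.
\<close>

section \<open>Commuting involutions\<close>

text \<open>The coefficients of W depend on the syndromes, so W describes H only inside one sector,
  and the diagonalisation has two stages: the stabilizers first, then the W of the sector found. The
  dimension count supplies an eigenvector for every admissible choice of signs. That no other
  eigenvalue occurs is not obtained by adding up dimensions over sectors but from one fact: a
  nonzero subspace stable under finitely many commuting involutions contains a joint eigenvector.
  Applied to an eigenspace of H, it identifies the eigenvalue; applied to the part of the ground
  space on which one of the involutions is -1, it shows that this part is zero. Hence the ground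
  space is exactly one joint eigenspace, and the dimension 4 becomes the degeneracy. The gap comes
  from the product relation: a syndrome defect is never alone, and two defects cost at least 2(2
  sqrt 2 - 2) = 4(sqrt 2 - 1), which is less than the 4 sqrt 2 for reversing one W in the sector
  without defects.\<close>

context vector_space
begin

lemma subspace_eigenspace:
  assumes "subspace V" "Vector_Spaces.linear scale scale F"
  shows "subspace {v \<in> V. F v = scale c v}"
proof -
  interpret F: Vector_Spaces.linear scale scale F by fact
  show ?thesis
    using assms(1) by (auto simp: subspace_def F.add F.scale scale_right_distrib scale_left_commute)
qed

text \<open>\<open>V\<close> is the direct sum of the eigenspaces of \<open>F\<close> for
  \<open>s\<close> and \<open>- s\<close>, and \<open>U\<close> exchanges the two, so they have
  equal dimension. The finite set \<open>B\<close> makes the basis \<open>b\<close> finite, without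
  which counting by \<open>card\<close> would be void.\<close>

lemma dim_anticommuting_involutions:
  assumes V: "subspace V" "V \<subseteq> span B" "finite B"
    and F: "Vector_Spaces.linear scale scale F" "F ` V \<subseteq> V" "\<And>v. v \<in> V \<Longrightarrow> F (F v) = v"
    and U: "Vector_Spaces.linear scale scale U" "U ` V \<subseteq> V" "\<And>v. v \<in> V \<Longrightarrow> U (U v) = v"
    and anti: "\<And>v. v \<in> V \<Longrightarrow> F (U v) = - U (F v)"
    and s: "s * s = 1" and two: "(2 :: 'a) \<noteq> 0"
  shows "dim V = 2 * dim {v \<in> V. F v = scale s v}"
proof -
  interpret F: Vector_Spaces.linear scale scale F by fact
  interpret U: Vector_Spaces.linear scale scale U by fact
  define E where "E = {v \<in> V. F v = scale s v}"
  define E' where "E' = {v \<in> V. F v = scale (- s) v}"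
  have sub: "subspace E" "subspace E'"
    unfolding E_def E'_def using V(1) F(1) by (rule subspace_eigenspace)+
  have s0: "s \<noteq> 0" using s by auto
  have E_Int: "v = 0" if "v \<in> E" "v \<in> E'" for v
  proof -
    have "scale s v = scale (- s) v" using that by (auto simp: E_def E'_def)
    then have "scale (2 * s) v = 0"
      by (metis add.right_inverse mult_2 scale_left_distrib scale_zero_left)
    then show ?thesis using two s0 by simp
  qed
  have UE: "U v \<in> E'" if "v \<in> E" for v
    using that U anti[of v] by (auto simp: E_def E'_def U.scale)
  have UE': "U v \<in> E" if "v \<in> E'" for v
    using that U anti[of v] by (auto simp: E_def E'_def U.scale U.neg)
  obtain b where b: "b \<subseteq> E" "independent b" "E \<subseteq> span b" "card b = dim E"
    using basis_exists by blast
  have bV: "b \<subseteq> V" using b(1) by (auto simp: E_def)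
  have finb: "finite b"
    using independent_span_bound[OF V(3) b(2)] bV V(2) by auto
  have spanb: "span b = E"
    using b sub(1) by (intro span_subspace) auto
  have spanU: "span (U ` b) = U ` E"
    using U.span_image spanb by auto
  have injU: "inj_on U E"
    by (rule inj_on_inverseI[of _ U]) (auto simp: E_def U)
  have indU: "independent (U ` b)"
    using U.independent_injective_image[OF b(2)] injU spanb by simp
  have ind: "independent (b \<union> c)" if "finite c" "c \<subseteq> U ` b" for c
    using that
  proof (induction c)
    case (insert x c)
    have "x \<notin> span (b \<union> c)"
    proof
      assume "x \<in> span (b \<union> c)"
      then obtain p q where pq: "p \<in> span b" "q \<in> span c" "x = p + q"
        by (auto simp: span_Un)
      have sc: "span c \<subseteq> E'" "x \<in> E'"
        using insert.prems span_mono[of c "U ` b"] spanU UE b(1) by auto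
      have "p = x - q" using pq by simp
      then have "p \<in> E'" using sc pq(2) subspace_diff[OF sub(2)] by auto
      then have "p = 0" using E_Int pq(1) spanb by auto
      then have "x \<in> span c" using pq by simp
      then have "dependent (insert x c)"
        using insert.hyps dependent_def by (metis Diff_insert_absorb insertI1)
      then show False
        using independent_mono[OF indU insert.prems] by blast
    qed
    then show ?case
      using insert independent_insertI by simp
  qed (use b in simp)
  have span: "V \<subseteq> span (b \<union> U ` b)"
  proof
    \<comment> \<open>\<open>p\<close> and \<open>q\<close> below are twice the projections of
      \<open>v\<close> to \<open>E\<close> and \<open>E'\<close>; since 2 is invertible, they
      recover \<open>v\<close>.\<close>
    fix v assume v: "v \<in> V"
    define p where "p = v + scale s (F v)"
    define q where "q = v - scale s (F v)"
    have pqV: "p \<in> V" "q \<in> V"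
      using v F V(1) unfolding p_def q_def
      by (auto intro!: subspace_scale subspace_add subspace_diff)
    have "F p = scale s p" "F q = scale (- s) q"
      using F(3)[OF v] s unfolding p_def q_def
      by (simp_all add: F.scale F.add F.diff scale_right_distrib scale_right_diff_distrib add.commute)
    then have pE: "p \<in> E" and qE: "q \<in> E'"
      using pqV by (auto simp: E_def E'_def)
    have "q = U (U q)" using U pqV by simp
    then have "q \<in> span (U ` b)"
      using UE'[OF qE] spanU by blast
    then have "p + q \<in> span (b \<union> U ` b)"
      using pE spanb unfolding span_Un by blast
    then have "scale (1 / 2) (p + q) \<in> span (b \<union> U ` b)"
      by (rule span_scale)
    moreover have "p + q = scale 2 v"
      using scale_left_distrib[of 1 1 v] unfolding p_def q_def by simp
    then have "scale (1 / 2) (p + q) = v"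
      using two by simp
    ultimately show "v \<in> span (b \<union> U ` b)"
      by simp
  qed
  have "b \<inter> U ` b = {}"
  proof (rule ccontr)
    assume "b \<inter> U ` b \<noteq> {}"
    then obtain v where "v \<in> b" "v \<in> U ` b" by blast
    then have "v \<in> E" "v \<in> E'" using b(1) UE by auto
    then have "v = 0" using E_Int by blast
    then show False using \<open>v \<in> b\<close> b(2) dependent_zero by blast
  qed
  then have "card (b \<union> U ` b) = 2 * card b"
    using finb card_image[OF inj_on_subset[OF injU b(1)]] by (simp add: card_Un_disjoint)
  moreover have "U ` b \<subseteq> V" using bV U by auto
  then have "card (b \<union> U ` b) = dim V"
    using bV span ind[of "U ` b"] finb by (intro basis_card_eq_dim) auto
  ultimately show ?thesis
    using b(4) unfolding E_def by simp
qed

text \<open>Impose the eigenvalue equations one at a time. The space cut out so far is stable under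
  the next \<open>F k\<close> by commutation and under \<open>U k\<close> because \<open>U k\<close>
  flips nothing but \<open>F k\<close>, so the halving lemma applies inside it.\<close>

lemma dim_joint_eigenspace:
  assumes "finite K" and V: "subspace V" "V \<subseteq> span B" "finite B"
    and F: "\<And>k. k \<in> K \<Longrightarrow> Vector_Spaces.linear scale scale (F k)"
      "\<And>k v. k \<in> K \<Longrightarrow> v \<in> V \<Longrightarrow> F k v \<in> V" "\<And>k v. k \<in> K \<Longrightarrow> v \<in> V \<Longrightarrow> F k (F k v) = v"
    and comm: "\<And>j k v. j \<in> K \<Longrightarrow> k \<in> K \<Longrightarrow> v \<in> V \<Longrightarrow> F j (F k v) = F k (F j v)"
    and U: "\<And>k. k \<in> K \<Longrightarrow> Vector_Spaces.linear scale scale (U k)"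
      "\<And>k v. k \<in> K \<Longrightarrow> v \<in> V \<Longrightarrow> U k v \<in> V" "\<And>k v. k \<in> K \<Longrightarrow> v \<in> V \<Longrightarrow> U k (U k v) = v"
    and flip: "\<And>k v. k \<in> K \<Longrightarrow> v \<in> V \<Longrightarrow> F k (U k v) = - U k (F k v)"
      "\<And>j k v. j \<in> K \<Longrightarrow> k \<in> K \<Longrightarrow> j \<noteq> k \<Longrightarrow> v \<in> V \<Longrightarrow> F j (U k v) = U k (F j v)"
    and s: "\<And>k. k \<in> K \<Longrightarrow> s k * s k = 1" and two: "(2 :: 'a) \<noteq> 0"
  shows "dim V = 2 ^ card K * dim {v \<in> V. \<forall>k\<in>K. F k v = scale (s k) v}"
proof -
  have "dim V = 2 ^ card J * dim {v \<in> V. \<forall>k\<in>J. F k v = scale (s k) v} \<and>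
    subspace {v \<in> V. \<forall>k\<in>J. F k v = scale (s k) v}"
    if "finite J" "J \<subseteq> K" for J
    using that
  proof (induction J)
    case (insert k J)
    let ?E = "{v \<in> V. \<forall>k\<in>J. F k v = scale (s k) v}"
    have J: "j \<in> K" "j \<noteq> k" if "j \<in> J" for j
      using insert.hyps insert.prems that by auto
    have k: "k \<in> K" using insert.prems by auto
    have IH: "dim V = 2 ^ card J * dim ?E" "subspace ?E"
      using insert by auto
    have eq: "{v \<in> V. \<forall>k\<in>insert k J. F k v = scale (s k) v} = {v \<in> ?E. F k v = scale (s k) v}"
      by auto
    have scale_F: "F j (scale c v) = scale c (F j v)" "U j (scale c v) = scale c (U j v)"
      if "j \<in> K" for j c v
      using linear_imp_scale F(1)[OF that] U(1)[OF that]
      by (simp_all add: Vector_Spaces.linear_iff)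
    have "F k ` ?E \<subseteq> ?E"
    proof clarify
      fix v assume "v \<in> V" "\<forall>j\<in>J. F j v = scale (s j) v"
      then show "F k v \<in> V \<and> (\<forall>j\<in>J. F j (F k v) = scale (s j) (F k v))"
        using F(2) comm[of _ k v] k J scale_F(1)[OF k] by simp
    qed
    moreover have "U k ` ?E \<subseteq> ?E"
    proof clarify
      fix v assume "v \<in> V" "\<forall>j\<in>J. F j v = scale (s j) v"
      then show "U k v \<in> V \<and> (\<forall>j\<in>J. F j (U k v) = scale (s j) (U k v))"
        using U(2) flip(2)[of _ k v] k J scale_F(2)[OF k] by simp
    qed
    ultimately have "dim ?E = 2 * dim {v \<in> ?E. F k v = scale (s k) v}"
      using F(1,3) U(1,3) flip(1) s k V IH(2) two
      by (intro dim_anticommuting_involutions[where U = "U k" and B = B]) auto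
    moreover have "subspace {v \<in> ?E. F k v = scale (s k) v}"
      using IH(2) F(1)[OF k] by (rule subspace_eigenspace)
    ultimately show ?case
      using IH(1) insert.hyps unfolding eq by simp
  qed (use V in simp)
  then show ?thesis using \<open>finite K\<close> by blast
qed

text \<open>For a single involution either \<open>F k w = - w\<close>, or \<open>w + F k w\<close>
  is a nonzero fixed vector; by commutation the latter keeps all eigenvalues already arranged. Since
  \<open>V\<close> is any stable subspace, the vector can be sought inside an eigenspace of
  H.\<close>

lemma joint_eigenvector:
  assumes "finite K" and V: "subspace V" "v \<in> V" "v \<noteq> 0"
    and F: "\<And>k. k \<in> K \<Longrightarrow> Vector_Spaces.linear scale scale (F k)"
      "\<And>k v. k \<in> K \<Longrightarrow> v \<in> V \<Longrightarrow> F k v \<in> V" "\<And>k v. k \<in> K \<Longrightarrow> v \<in> V \<Longrightarrow> F k (F k v) = v"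
    and comm: "\<And>j k v. j \<in> K \<Longrightarrow> k \<in> K \<Longrightarrow> v \<in> V \<Longrightarrow> F j (F k v) = F k (F j v)"
  obtains s w where "w \<in> V" "w \<noteq> 0" "\<And>k. k \<in> K \<Longrightarrow> s k \<in> {1, -1}"
    "\<And>k. k \<in> K \<Longrightarrow> F k w = scale (s k) w"
proof -
  have "\<exists>s w. w \<in> V \<and> w \<noteq> 0 \<and> (\<forall>k\<in>J. s k \<in> {1, -1} \<and> F k w = scale (s k) w)"
    if "finite J" "J \<subseteq> K" for J
    using that
  proof (induction J)
    case (insert k J)
    then obtain s w where w: "w \<in> V" "w \<noteq> 0"
      "\<And>j. j \<in> J \<Longrightarrow> s j \<in> {1, -1} \<and> F j w = scale (s j) w" by auto
    have k: "k \<in> K" "\<And>j. j \<in> J \<Longrightarrow> j \<in> K" "\<And>j. j \<in> J \<Longrightarrow> j \<noteq> k"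
      using insert by auto
    interpret Fk: Vector_Spaces.linear scale scale "F k" using F k by auto
    show ?case
    proof (cases "F k w = - w")
      case True
      then have "\<forall>j\<in>insert k J. (s(k := -1)) j \<in> {1, -1} \<and> F j w = scale ((s(k := -1)) j) w"
        using w(3) k(3) by auto
      then show ?thesis using w by blast
    next
      case False
      define u where "u = w + F k w"
      have "u \<in> V" using w k F V by (auto simp: u_def intro: subspace_add)
      moreover have "u \<noteq> 0"
        using False by (auto simp: u_def eq_neg_iff_add_eq_0 add.commute)
      moreover have "F k u = u"
        using F k w by (simp add: u_def Fk.add add.commute)
      moreover have "F j u = scale (s j) u" if "j \<in> J" for j
      proof -
        interpret Fj: Vector_Spaces.linear scale scale "F j" using F k that by auto
        show ?thesis using comm[of j k w] w k that
          by (simp add: u_def Fj.add Fk.scale scale_right_distrib)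
      qed
      ultimately have
        "\<forall>j\<in>insert k J. (s(k := 1)) j \<in> {1, -1} \<and> F j u = scale ((s(k := 1)) j) u"
        using w(3) k(3) by auto
      then show ?thesis using \<open>u \<in> V\<close> \<open>u \<noteq> 0\<close> by blast
    qed
  next
    case empty
    show ?case using V(2,3) by blast
  qed
  from this[OF \<open>finite K\<close> order.refl] show ?thesis using that by metis
qed

end

section \<open>Pauli strings\<close>

abbreviation op_linear :: "(state \<Rightarrow> state) \<Rightarrow> bool" where
  "op_linear \<equiv> Vector_Spaces.linear cscale cscale"

text \<open>A product of Pauli operators of one kind on distinct qubits depends only on the set of
  these qubits. Composition of X strings becomes symmetric difference, and exchanging an X string
  with a Z string becomes a question of parity.\<close>

definition X_string :: "qubit set \<Rightarrow> state \<Rightarrow> state" where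
  "X_string a \<psi> = (\<lambda>A. \<psi> (sym_diff A a))"

text \<open>\<open>card\<close> is 0 on infinite sets, so an infinite overlap would give no sign;
  this is why the union law and the exchange law with X strings ask for finite sets.\<close>

definition Z_string :: "qubit set \<Rightarrow> state \<Rightarrow> state" where
  "Z_string b \<psi> = (\<lambda>A. (-1) ^ card (A \<inter> b) * \<psi> A)"

lemma op_linear_iff:
  "op_linear F \<longleftrightarrow> (\<forall>\<psi> \<phi>. F (\<psi> + \<phi>) = F \<psi> + F \<phi>) \<and> (\<forall>c \<psi>. F (cscale c \<psi>) = cscale c (F \<psi>))"
  unfolding Vector_Spaces.linear_iff using qstate.vector_space_axioms by simp

lemma op_linear_X_string: "op_linear (X_string a)"
  by (auto simp: op_linear_iff X_string_def cscale_def fun_eq_iff)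

lemma op_linear_Z_string: "op_linear (Z_string b)"
  by (auto simp: op_linear_iff Z_string_def cscale_def fun_eq_iff algebra_simps)

lemma X_string_X_string: "X_string a (X_string b \<psi>) = X_string (sym_diff a b) \<psi>"
  unfolding X_string_def by (rule ext, rule arg_cong[where f = \<psi>]) blast

lemma X_string_Un: "a \<inter> b = {} \<Longrightarrow> X_string (a \<union> b) \<psi> = X_string a (X_string b \<psi>)"
  unfolding X_string_X_string by (rule arg_cong[where f = "\<lambda>c. X_string c \<psi>"]) blast

lemma X_string_empty [simp]: "X_string {} \<psi> = \<psi>"
  by (simp add: X_string_def)

lemma X_string_involution [simp]: "X_string a (X_string a \<psi>) = \<psi>"
  by (simp add: X_string_X_string)

lemma X_string_commute: "X_string a (X_string b \<psi>) = X_string b (X_string a \<psi>)"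
  unfolding X_string_X_string by (rule arg_cong[where f = "\<lambda>c. X_string c \<psi>"]) blast

lemma Z_string_Un:
  assumes "a \<inter> b = {}" "finite a" "finite b"
  shows "Z_string (a \<union> b) \<psi> = Z_string a (Z_string b \<psi>)"
proof
  fix A
  have "card (A \<inter> (a \<union> b)) = card (A \<inter> a) + card (A \<inter> b)"
    unfolding Int_Un_distrib using assms by (intro card_Un_disjoint) auto
  then show "Z_string (a \<union> b) \<psi> A = Z_string a (Z_string b \<psi>) A"
    by (simp add: Z_string_def power_add)
qed

lemma Z_string_involution [simp]: "Z_string a (Z_string a \<psi>) = \<psi>"
  by (simp add: Z_string_def fun_eq_iff flip: mult.assoc power_add)

lemma Z_string_commute: "Z_string a (Z_string b \<psi>) = Z_string b (Z_string a \<psi>)"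
  by (simp add: Z_string_def fun_eq_iff)

text \<open>The common part of \<open>A\<close> and \<open>B\<close> is counted twice, so overlap
  parity is additive over Z/2. This gives the sign rule for Pauli strings and lets flips be
  concatenated along a path.\<close>

lemma odd_card_sym_diff:
  assumes "finite S"
  shows "odd (card (sym_diff A B \<inter> S)) \<longleftrightarrow> (odd (card (A \<inter> S)) \<noteq> odd (card (B \<inter> S)))"
proof -
  have fin: "finite (T \<inter> S)" for T using assms by simp
  have "A \<inter> S = ((A - B) \<inter> S) \<union> (A \<inter> B \<inter> S)" "B \<inter> S = ((B - A) \<inter> S) \<union> (A \<inter> B \<inter> S)"
    "sym_diff A B \<inter> S = ((A - B) \<inter> S) \<union> ((B - A) \<inter> S)" by auto
  moreover have "card (((A - B) \<inter> S) \<union> (A \<inter> B \<inter> S)) = card ((A - B) \<inter> S) + card (A \<inter> B \<inter> S)"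
    "card (((B - A) \<inter> S) \<union> (A \<inter> B \<inter> S)) = card ((B - A) \<inter> S) + card (A \<inter> B \<inter> S)"
    "card (((A - B) \<inter> S) \<union> ((B - A) \<inter> S)) = card ((A - B) \<inter> S) + card ((B - A) \<inter> S)"
    by (rule card_Un_disjoint; use fin in blast)+
  ultimately show ?thesis by (metis even_add)
qed

lemma even_card_pair:
  assumes "x \<noteq> y"
  shows "even (card ({x, y} \<inter> S)) \<longleftrightarrow> (x \<in> S \<longleftrightarrow> y \<in> S)"
  using assms by (simp add: Int_insert_left)

lemma odd_card_triple:
  assumes "x \<noteq> y" "y \<noteq> w" "x \<noteq> w"
  shows "odd (card ({x, y, w} \<inter> S)) \<longleftrightarrow> ((x \<in> S) \<noteq> (y \<in> S)) \<noteq> (w \<in> S)"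
  using assms by (simp add: Int_insert_left)

text \<open>Each qubit common to \<open>a\<close> and \<open>b\<close> contributes one sign, since X
  and Z anticommute on it.\<close>

lemma Z_string_X_string:
  assumes "finite b"
  shows "Z_string b (X_string a \<psi>) =
    (if odd (card (a \<inter> b)) then - X_string a (Z_string b \<psi>) else X_string a (Z_string b \<psi>))"
proof
  fix A
  show "Z_string b (X_string a \<psi>) A = (if odd (card (a \<inter> b)) then - X_string a (Z_string b \<psi>)
    else X_string a (Z_string b \<psi>)) A"
    using odd_card_sym_diff[OF assms, of A a]
    unfolding Z_string_def X_string_def
    by (cases "odd (card (A \<inter> b))"; cases "odd (card (a \<inter> b))") (simp_all only: fun_Compl_def; simp)+
qed

lemma X_string_Z_string:
  assumes "finite b"
  shows "X_string a (Z_string b \<psi>) =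
    (if odd (card (a \<inter> b)) then - Z_string b (X_string a \<psi>) else Z_string b (X_string a \<psi>))"
  unfolding Z_string_X_string[OF assms] by (simp split: if_split)

lemma pauli_X_eq: "pauli_X q = X_string {q}"
  by (auto simp: pauli_X_def X_string_def fun_eq_iff insert_Diff_if Un_commute)

lemma pauli_Z_eq: "pauli_Z q = Z_string {q}"
  by (auto simp: pauli_Z_def Z_string_def fun_eq_iff)

section \<open>The Hilbert space of the lattice and its dimension\<close>

lemma subspace_hilbert: "qstate.subspace (hilbert L)"
  by (auto simp: qstate.subspace_def hilbert_def cscale_def)

lemma X_string_hilbert:
  assumes "a \<subseteq> qubits L" "\<psi> \<in> hilbert L"
  shows "X_string a \<psi> \<in> hilbert L"
proof -
  have "\<not> sym_diff A a \<subseteq> qubits L" if "\<not> A \<subseteq> qubits L" for A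
    using that assms(1) by blast
  then show ?thesis
    using assms(2) unfolding hilbert_def X_string_def mem_Collect_eq by metis
qed

lemma Z_string_hilbert: "\<psi> \<in> hilbert L \<Longrightarrow> Z_string b \<psi> \<in> hilbert L"
  unfolding hilbert_def Z_string_def by auto

definition basis_state :: "qubit set \<Rightarrow> state" where
  "basis_state A = (\<lambda>B. if B = A then 1 else 0)"

lemma inj_basis_state: "inj basis_state"
  by (rule injI) (metis basis_state_def zero_neq_one)

lemma finite_sites: "finite (sites L)"
  by (simp add: sites_def)

lemma card_sites: "card (sites L) = L\<^sup>2"
  by (simp add: sites_def power2_eq_square)

lemma finite_qubits: "finite (qubits L)"
  by (simp add: qubits_def finite_sites)

lemma card_qubits: "card (qubits L) = 3 * L\<^sup>2"
proof -
  have "card (Vertex ` sites L \<union> HEdge ` sites L \<union> VEdge ` sites L)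
    = card (Vertex ` sites L) + card (HEdge ` sites L) + card (VEdge ` sites L)"
    using finite_sites by (subst card_Un_disjoint; (subst card_Un_disjoint)?; auto)
  then show ?thesis
    by (simp add: qubits_def card_image inj_on_def card_sites)
qed

lemma basis_hilbert:
  fixes L defines "B \<equiv> basis_state ` Pow (qubits L)"
  shows "finite B" "card B = 2 ^ card (qubits L)" "qstate.independent B" "B \<subseteq> hilbert L"
    "hilbert L \<subseteq> qstate.span B"
proof -
  show fin: "finite B"
    by (simp add: B_def finite_qubits)
  show "card B = 2 ^ card (qubits L)"
    unfolding B_def by (subst card_image)
      (auto simp: card_Pow finite_qubits intro: inj_on_subset[OF inj_basis_state])
  show "B \<subseteq> hilbert L"
    by (auto simp: B_def hilbert_def basis_state_def split: if_splits)
  \<comment> \<open>Evaluating a combination of basis states at \<open>A\<close> isolates one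
    coefficient; independence and spanning are both read off from this.\<close>
  have expand: "(\<Sum>v\<in>B. cscale (u v) v) A = (if A \<subseteq> qubits L then u (basis_state A) else 0)" for u A
  proof -
    have "(\<Sum>v\<in>B. cscale (u v) v) A = (\<Sum>v\<in>B. cscale (u v) v A)"
      using fin by (induction B rule: finite_induct) auto
    also have "\<dots> = (\<Sum>C\<in>Pow (qubits L). cscale (u (basis_state C)) (basis_state C) A)"
      unfolding B_def by (subst sum.reindex) (auto intro: inj_on_subset[OF inj_basis_state])
    also have "\<dots> = (\<Sum>C\<in>Pow (qubits L). if A = C then u (basis_state C) else 0)"
      by (intro sum.cong) (auto simp: cscale_def basis_state_def)
    finally show ?thesis by (simp add: finite_qubits)
  qed
  show "qstate.independent B"
  proof
    assume "qstate.dependent B"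
    then obtain u v where uv: "v \<in> B" "u v \<noteq> 0" "(\<Sum>v\<in>B. cscale (u v) v) = 0"
      using qstate.dependent_finite[OF fin] by auto
    then obtain A where "A \<subseteq> qubits L" "v = basis_state A"
      by (auto simp: B_def)
    then show False
      using expand[of u A] uv by simp
  qed
  show "hilbert L \<subseteq> qstate.span B"
  proof
    fix \<psi> assume \<psi>: "\<psi> \<in> hilbert L"
    define u where "u v = \<psi> (inv basis_state v)" for v
    have "\<psi> = (\<Sum>v\<in>B. cscale (u v) v)"
      using \<psi> expand[of u] inj_basis_state by (auto simp: fun_eq_iff u_def hilbert_def)
    moreover have "(\<Sum>v\<in>B. cscale (u v) v) \<in> qstate.span B"
      by (intro qstate.span_sum qstate.span_scale qstate.span_base)
    ultimately show "\<psi> \<in> qstate.span B"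
      by argo
  qed
qed

lemma dim_hilbert: "qstate.dim (hilbert L) = 2 ^ (3 * L\<^sup>2)"
  using qstate.basis_card_eq_dim[OF basis_hilbert(4,5,3)[of L]] basis_hilbert(2)[of L]
  by (simp add: card_qubits)

section \<open>Geometry of the triangles\<close>

definition support :: "nat \<Rightarrow> corner \<Rightarrow> site \<Rightarrow> qubit set" where
  "support L c p = (case triangle_of L c p of (u, f, g) \<Rightarrow> {u, f, g})"

lemma finite_support: "finite (support L c p)"
  by (auto simp: support_def split: prod.split)

definition is_X :: "corner \<Rightarrow> bool" where
  "is_X c \<longleftrightarrow> c = SW \<or> c = NE"

lemma is_X_simps [simp]: "is_X SW" "is_X NE" "\<not> is_X SE" "\<not> is_X NW"
  by (simp_all add: is_X_def)

text \<open>For \<open>L = 1\<close> the maps \<open>east\<close> and \<open>north\<close> fix every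
  site and the corners of a plaquette coincide; the bound keeps them apart.\<close>

locale torus =
  fixes L :: nat
  assumes L_ge_2: "2 \<le> L"
begin

lemma origin_in_sites: "(0, 0) \<in> sites L"
  using L_ge_2 by (simp add: sites_def)

lemma east_in_sites: "p \<in> sites L \<Longrightarrow> east L p \<in> sites L"
  by (cases p) (auto simp: sites_def)

lemma north_in_sites: "p \<in> sites L \<Longrightarrow> north L p \<in> sites L"
  by (cases p) (auto simp: sites_def)

lemma east_eq_iff: "p \<in> sites L \<Longrightarrow> q \<in> sites L \<Longrightarrow> east L p = east L q \<longleftrightarrow> p = q"
  by (cases p; cases q) (auto simp: sites_def Suc_mod_inj)

lemma north_eq_iff: "p \<in> sites L \<Longrightarrow> q \<in> sites L \<Longrightarrow> north L p = north L q \<longleftrightarrow> p = q"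
  by (cases p; cases q) (auto simp: sites_def Suc_mod_inj)

lemma north_east: "north L (east L p) = east L (north L p)"
  by (cases p) simp

lemma image_sites:
  assumes "f ` sites L \<subseteq> sites L" "\<And>p q. p \<in> sites L \<Longrightarrow> q \<in> sites L \<Longrightarrow> f p = f q \<longleftrightarrow> p = q"
  shows "f ` sites L = sites L"
  using assms finite_sites by (metis endo_inj_surj inj_onI)

lemma image_east: "east L ` sites L = sites L"
  using east_in_sites east_eq_iff by (intro image_sites) auto

lemma image_north: "north L ` sites L = sites L"
  using north_in_sites north_eq_iff by (intro image_sites) auto

lemma east_north_eq_iff:
  "p \<in> sites L \<Longrightarrow> q \<in> sites L \<Longrightarrow> east L (north L p) = north L q \<longleftrightarrow> east L p = q"
  "p \<in> sites L \<Longrightarrow> q \<in> sites L \<Longrightarrow> north L q = east L (north L p) \<longleftrightarrow> q = east L p"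
  using north_eq_iff[of "east L p" q] north_eq_iff[of q "east L p"]
  by (simp_all add: north_east east_in_sites)

lemma north_neq_east: "p \<in> sites L \<Longrightarrow> north L p \<noteq> east L p"
  using Suc_mod_neq[OF L_ge_2] by (cases p) (auto simp: sites_def)

lemmas site_simps = north_neq_east east_north_eq_iff east_in_sites north_in_sites east_eq_iff north_eq_iff north_east

lemma mem_support:
  "q \<in> support L SW p \<longleftrightarrow> q \<in> {Vertex p, HEdge p, VEdge p}"
  "q \<in> support L SE p \<longleftrightarrow> q \<in> {Vertex (east L p), HEdge p, VEdge (east L p)}"
  "q \<in> support L NW p \<longleftrightarrow> q \<in> {Vertex (north L p), HEdge (north L p), VEdge p}"
  "q \<in> support L NE p \<longleftrightarrow> q \<in> {Vertex (east L (north L p)), HEdge (north L p), VEdge (east L p)}"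
  by (simp_all add: support_def north_east)

text \<open>Within one plaquette an X triangle and a Z triangle share exactly one edge. In different
  plaquettes they share nothing, or their vertex together with one edge at it, which is an even
  overlap.\<close>

lemma odd_support_Int:
  assumes "is_X c" "\<not> is_X d" "p \<in> sites L" "q \<in> sites L"
  shows "odd (card (support L c p \<inter> support L d q)) \<longleftrightarrow> p = q"
proof -
  have eq: "support L SW p = {Vertex p, HEdge p, VEdge p}"
    "support L NE p = {Vertex (east L (north L p)), HEdge (north L p), VEdge (east L p)}"
    by (simp_all add: support_def north_east)
  have "c = SW \<or> c = NE" "d = SE \<or> d = NW"
    using assms(1,2) by (cases c; cases d; simp)+
  then show ?thesis
    using assms(3,4)
    by (elim disjE)
       (auto simp: eq odd_card_triple mem_support site_simps)
qed

lemma support_disjoint: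
  assumes "p \<in> sites L" "q \<in> sites L" "p \<noteq> q"
  shows "support L c p \<inter> support L c q = {}"
  using assms by (cases c) (auto simp: mem_support site_simps)

text \<open>Vertex, horizontal edge and vertical edge of the triangle are each a translate of
  \<open>p\<close>, and translations permute the sites of the torus; here the periodic boundary
  enters.\<close>

lemma Union_support: "(\<Union>p\<in>sites L. support L c p) = qubits L"
proof -
  have "(\<Union>p\<in>sites L. {Vertex (f p), HEdge (g p), VEdge (h p)}) =
      Vertex ` f ` sites L \<union> HEdge ` g ` sites L \<union> VEdge ` h ` sites L" for f g h
    by auto
  moreover have "(\<lambda>p. east L (north L p)) ` sites L = sites L"
    using image_east image_north by (metis image_image)
  ultimately show ?thesis
    by (cases c) (simp_all add: support_def qubits_def image_east image_north north_east)
qed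

lemma support_subset: "p \<in> sites L \<Longrightarrow> support L c p \<subseteq> qubits L"
  using Union_support by blast

text \<open>\<open>has_type\<close> quantifies over all plaquettes, so a triangle must be kept from
  appearing at another corner of another plaquette. The injectivity of \<open>triangle_of\<close> on
  pairs of corner and plaquette excludes this.\<close>

lemma has_type_triangle_of:
  assumes "p \<in> sites L"
  shows "has_type L c (triangle_of L d p) \<longleftrightarrow> c = d"
proof
  assume "has_type L c (triangle_of L d p)"
  then obtain q where q: "q \<in> sites L" "at_corner L c q (triangle_of L d p)"
    by (auto simp: has_type_def)
  have "triangle_of L d p \<in> triangles L"
    using triangle_of_correct[OF L_ge_2 assms, of _ d] by blast
  then have "triangle_of L d p = triangle_of L c q"
    using triangle_of_correct[OF L_ge_2 q(1), of _ c] q(2) by blast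
  then have "(d, p) = (c, q)"
    using bij_betw_triangle_of[OF L_ge_2] q(1) assms
    by (auto simp: bij_betw_def dest!: inj_onD[where x = "(d, p)" and y = "(c, q)"])
  then show "c = d" by simp
next
  assume "c = d"
  then show "has_type L c (triangle_of L d p)"
    using triangle_of_correct[OF L_ge_2 assms, of _ d] assms unfolding has_type_def by blast
qed

section \<open>Triangle operators, Hamiltonian and stabilizers as Pauli strings\<close>

lemma G_triangle_of:
  assumes "p \<in> sites L"
  shows "G L (triangle_of L c p) =
    (if is_X c then X_string (support L c p) else Z_string (support L c p))"
proof -
  obtain u f g where T: "triangle_of L c p = (u, f, g)"
    by (metis prod_cases3)
  have distinct: "u \<noteq> f" "u \<noteq> g" "f \<noteq> g"
    using T by (cases c; auto)+
  have S: "support L c p = {u} \<union> ({f} \<union> {g})"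
    using T by (auto simp: support_def)
  have "is_X c \<longleftrightarrow> has_type L SW (u, f, g) \<or> has_type L NE (u, f, g)"
    using has_type_triangle_of[OF assms, of _ c] T by (auto simp: is_X_def)
  moreover have "X_string (support L c p) \<psi> = (pauli_X u \<circ> pauli_X f \<circ> pauli_X g) \<psi>"
    "Z_string (support L c p) \<psi> = (pauli_Z u \<circ> pauli_Z f \<circ> pauli_Z g) \<psi>" for \<psi>
    unfolding S pauli_X_eq pauli_Z_eq o_apply using distinct
    by (subst X_string_Un X_string_Un[of "{f}"] Z_string_Un Z_string_Un[of "{f}"];
        (subst X_string_Un Z_string_Un)?; simp)+
  ultimately show ?thesis
    unfolding T by (auto simp: fun_eq_iff)
qed

lemma hamiltonian_eq:
  "hamiltonian L \<psi> = - (\<Sum>p\<in>sites L.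
     X_string (support L SW p) \<psi> + X_string (support L NE p) \<psi> +
     (Z_string (support L SE p) \<psi> + Z_string (support L NW p) \<psi>))"
proof -
  have UNIV: "(UNIV :: corner set) = {SW, NE, SE, NW}"
    using corner.exhaust by auto
  have "(\<Sum>T\<in>triangles L. G L T \<psi>) =
      (\<Sum>(c, p)\<in>UNIV \<times> sites L. G L (triangle_of L c p) \<psi>)"
    by (subst sum.reindex_bij_betw[OF bij_betw_triangle_of[OF L_ge_2], symmetric])
       (auto intro: sum.cong)
  also have "\<dots> = (\<Sum>c\<in>UNIV. \<Sum>p\<in>sites L. G L (triangle_of L c p) \<psi>)"
    by (rule sum.cartesian_product[symmetric])
  also have "\<dots> = (\<Sum>p\<in>sites L. \<Sum>c\<in>UNIV. G L (triangle_of L c p) \<psi>)"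
    by (rule sum.swap)
  finally show ?thesis
    unfolding hamiltonian_def by (simp add: UNIV G_triangle_of add.assoc)
qed

lemma stab_X_eq: "p \<in> sites L \<Longrightarrow>
    stab_X L p \<psi> = X_string (support L SW p) (X_string (support L NE p) \<psi>)"
  by (simp add: stab_X_def G_triangle_of del: G.simps triangle_of.simps)

lemma stab_Z_eq: "p \<in> sites L \<Longrightarrow>
    stab_Z L p \<psi> = Z_string (support L SE p) (Z_string (support L NW p) \<psi>)"
  by (simp add: stab_Z_def G_triangle_of del: G.simps triangle_of.simps)

text \<open>
  A single edge would meet a triangle of type \<open>d\<close> in one qubit; adding the vertex of that triangle
  makes the overlap even, so that the flip commutes with all triangle operators of type \<open>d\<close>.
\<close>

lemma edge_flip:
  assumes "p \<in> sites L" "p' = east L p \<or> p' = north L p" "(d, e) \<in> {(SW, NE), (SE, NW)}"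
  shows "\<exists>c \<subseteq> qubits L. \<forall>q\<in>sites L. even (card (c \<inter> support L d q)) \<and>
    (odd (card (c \<inter> support L e q)) \<longleftrightarrow> (q = p) \<noteq> (q = p'))"
proof -
  let ?ne = "east L (north L p)"
  define c where "c = (if d = SW
    then {Vertex ?ne, if p' = east L p then HEdge ?ne else VEdge ?ne}
    else if p' = east L p then {Vertex ?ne, HEdge (north L p)}
    else {Vertex (north L p), VEdge (north L p)})"
  have "c \<subseteq> qubits L"
    using assms site_simps by (auto simp: c_def qubits_def)
  moreover have "even (card (c \<inter> support L d q)) \<and>
    (odd (card (c \<inter> support L e q)) \<longleftrightarrow> (q = p) \<noteq> (q = p'))" if "q \<in> sites L" for q
    using assms that
    by (auto simp: c_def even_card_pair mem_support site_simps)
  ultimately show ?thesis by blast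
qed

text \<open>The product relation forbids flipping one stabilizer alone, so each flip is paired with
  the origin. Edge flips are composed by symmetric difference along a path from the origin, first
  along the row and then up the column; the contributions at intermediate plaquettes cancel.\<close>

lemma path_flip:
  assumes "p \<in> sites L" "(d, e) \<in> {(SW, NE), (SE, NW)}"
  shows "\<exists>c \<subseteq> qubits L. \<forall>q\<in>sites L. even (card (c \<inter> support L d q)) \<and>
    (odd (card (c \<inter> support L e q)) \<longleftrightarrow> (q = p) \<noteq> (q = (0, 0)))" (is "?P p")
proof -
  have step: "?P p'"
    if P: "?P p" and p: "p \<in> sites L" "p' = east L p \<or> p' = north L p" for p p'
  proof -
    from P obtain a where a: "a \<subseteq> qubits L" "\<And>q. q \<in> sites L \<Longrightarrow> even (card (a \<inter> support L d q)) \<and>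
      (odd (card (a \<inter> support L e q)) \<longleftrightarrow> (q = p) \<noteq> (q = (0, 0)))"
      by (elim exE conjE) simp
    from edge_flip[OF p assms(2)] obtain b where b: "b \<subseteq> qubits L" "\<And>q. q \<in> sites L \<Longrightarrow> even (card (b \<inter> support L d q)) \<and>
      (odd (card (b \<inter> support L e q)) \<longleftrightarrow> (q = p) \<noteq> (q = p'))"
      by (elim exE conjE) simp
    have "sym_diff a b \<subseteq> qubits L"
      using a b by blast
    moreover have "even (card (sym_diff a b \<inter> support L d q)) \<and>
      (odd (card (sym_diff a b \<inter> support L e q)) \<longleftrightarrow> (q = p') \<noteq> (q = (0, 0)))"
      if "q \<in> sites L" for q
      using a(2)[OF that] b(2)[OF that] odd_card_sym_diff[OF finite_support, of a b] by metis
    ultimately show ?thesis by blast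
  qed
  obtain i j where p: "p = (i, j)" "i < L" "j < L"
    using assms by (auto simp: sites_def)
  have row: "?P (k, 0)" if "k < L" for k
    using that
  proof (induction k)
    case 0
    show ?case by (intro exI[of _ "{}"]) simp
  next
    case (Suc k)
    then show ?case
      using step[of "(k, 0)" "(Suc k, 0)"] by (simp add: sites_def)
  qed
  have "?P (i, k)" if "k < L" for k
    using that
  proof (induction k)
    case 0
    show ?case using row p by simp
  next
    case (Suc k)
    then show ?case
      using step[of "(i, k)" "(i, Suc k)"] p by (simp add: sites_def)
  qed
  then show ?thesis using p by simp
qed

text \<open>\<open>R\<close> stands for \<open>X_string\<close> or \<open>Z_string\<close>. On
  \<psi> the relation says that the triangle at \<open>c\<close> acts as \<open>x p\<close> times
  the triangle at \<open>d\<close>; as triangles of one type are disjoint, these replacements can be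
  multiplied plaquette by plaquette.\<close>

lemma string_Union_relation:
  assumes lin: "\<And>s. op_linear (R s)" and inv: "\<And>s \<psi>. R s (R s \<psi>) = \<psi>"
    and comm: "\<And>s t \<psi>. R s (R t \<psi>) = R t (R s \<psi>)"
    and Un: "\<And>s t \<psi>. finite s \<Longrightarrow> finite t \<Longrightarrow> s \<inter> t = {} \<Longrightarrow> R (s \<union> t) \<psi> = R s (R t \<psi>)"
    and P: "finite P" "P \<subseteq> sites L"
    and rel: "\<And>p. p \<in> P \<Longrightarrow> R (support L c p) (R (support L d p) \<psi>) = cscale (x p) \<psi>"
  shows "R (\<Union>p\<in>P. support L c p) \<psi> = cscale (\<Prod>p\<in>P. x p) (R (\<Union>p\<in>P. support L d p) \<psi>)"
  using P rel
proof (induction P)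
  case (insert p P)
  let ?U = "\<lambda>c. \<Union>p\<in>P. support L c p"
  have scale: "R s (cscale a \<phi>) = cscale a (R s \<phi>)" for s a \<phi>
    using lin op_linear_iff by blast
  have Un': "R (\<Union>p\<in>insert p P. support L c p) \<psi> = R (support L c p) (R (?U c) \<psi>)" for c
  proof -
    have "support L c p \<inter> ?U c = {}"
      using insert.hyps insert.prems(1) support_disjoint[of p _ c] by blast
    then show ?thesis
      using Un[of "support L c p" "?U c"] insert.hyps(1) finite_support by simp
  qed
  have p: "R (support L c p) \<psi> = cscale (x p) (R (support L d p) \<psi>)"
  proof -
    have "R (support L d p) (R (support L c p) \<psi>) = cscale (x p) \<psi>"
      using insert.prems(2)[of p] comm by simp
    then show ?thesis using inv scale by metis
  qed
  have "R (support L c p) (R (?U c) \<psi>) = R (support L c p) (cscale (\<Prod>p\<in>P. x p) (R (?U d) \<psi>))"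
    using insert by simp
  also have "\<dots> = cscale (\<Prod>p\<in>P. x p) (R (?U d) (R (support L c p) \<psi>))"
    using comm scale by simp
  also have "\<dots> = cscale (\<Prod>p\<in>insert p P. x p) (R (support L d p) (R (?U d) \<psi>))"
    using comm scale p insert.hyps by (simp add: mult.commute)
  finally show ?case unfolding Un' .
next
  case empty
  show ?case by (simp add: cscale_def)
qed

text \<open>Over all plaquettes both corner types cover the same set \<open>qubits L\<close>. The
  same invertible operator then stands on both sides, and the factor between them must be 1.\<close>

lemma prod_syndrome:
  assumes lin: "\<And>s. op_linear (R s)" and inv: "\<And>s \<psi>. R s (R s \<psi>) = \<psi>"
    and comm: "\<And>s t \<psi>. R s (R t \<psi>) = R t (R s \<psi>)"
    and Un: "\<And>s t \<psi>. finite s \<Longrightarrow> finite t \<Longrightarrow> s \<inter> t = {} \<Longrightarrow> R (s \<union> t) \<psi> = R s (R t \<psi>)"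
    and rel: "\<And>p. p \<in> sites L \<Longrightarrow> R (support L c p) (R (support L d p) \<psi>) = cscale (x p) \<psi>"
    and \<psi>: "\<psi> \<noteq> 0"
  shows "(\<Prod>p\<in>sites L. x p) = 1"
proof -
  have "R (qubits L) \<psi> = cscale (\<Prod>p\<in>sites L. x p) (R (qubits L) \<psi>)"
    using string_Union_relation[where R = R and P = "sites L" and c = c and d = d,
        OF lin inv comm Un finite_sites order.refl rel]
    unfolding Union_support by blast
  then have "cscale 1 (R (qubits L) \<psi>) = cscale (\<Prod>p\<in>sites L. x p) (R (qubits L) \<psi>)"
    by (simp only: qstate.scale_one)
  moreover have "R (qubits L) \<psi> \<noteq> 0"
  proof
    assume "R (qubits L) \<psi> = 0"
    then have "\<psi> = R (qubits L) 0" using inv by metis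
    also have "\<dots> = 0"
      using lin[of "qubits L"] qstate.scale_zero_left unfolding op_linear_iff by metis
    finally show False using \<psi> by simp
  qed
  ultimately show ?thesis
    by (simp only: qstate.scale_cancel_right) simp
qed

end

section \<open>Stabilizers and gauge operators\<close>

lemma op_linearD:
  assumes "op_linear F"
  shows "F (\<psi> + \<phi>) = F \<psi> + F \<phi>" "F (cscale c \<psi>) = cscale c (F \<psi>)" "F 0 = 0" "F (- \<psi>) = - F \<psi>"
    "F (\<psi> - \<phi>) = F \<psi> - F \<phi>" "F (sum f A) = (\<Sum>i\<in>A. F (f i))"
proof -
  interpret F: Vector_Spaces.linear cscale cscale F by fact
  show "F (\<psi> + \<phi>) = F \<psi> + F \<phi>" "F (cscale c \<psi>) = cscale c (F \<psi>)" "F 0 = 0" "F (- \<psi>) = - F \<psi>"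
    "F (\<psi> - \<phi>) = F \<psi> - F \<phi>" "F (sum f A) = (\<Sum>i\<in>A. F (f i))"
    by (rule F.add F.scale F.zero F.neg F.diff F.sum)+
qed

lemmas string_linear [simp] =
  op_linearD[OF op_linear_X_string] op_linearD[OF op_linear_Z_string]

datatype generator = Gen_X site | Gen_Z site | Gen_W site

text \<open>The stabilizers and the W operators get separate index sets because three families
  occur: all but the origin stabilizers together with every W for the dimension count, the
  stabilizers alone to find a sector, and the W alone to work inside one.\<close>

definition generators :: "site set \<Rightarrow> site set \<Rightarrow> generator set" where
  "generators P Q = Gen_X ` P \<union> Gen_Z ` P \<union> Gen_W ` Q"

context torus
begin

lemma Z_X_support:
  assumes "is_X c" "\<not> is_X d" "p \<in> sites L" "q \<in> sites L"
  shows "Z_string (support L d q) (X_string (support L c p) \<psi>) =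
    (if p = q then - X_string (support L c p) (Z_string (support L d q) \<psi>)
     else X_string (support L c p) (Z_string (support L d q) \<psi>))"
  using odd_support_Int[OF assms] Z_string_X_string[OF finite_support] by simp

definition gauge_op :: "complex \<Rightarrow> complex \<Rightarrow> site \<Rightarrow> state \<Rightarrow> state" where
  "gauge_op a b p \<psi> = cscale a (X_string (support L SW p) \<psi>) + cscale b (Z_string (support L SE p) \<psi>)"

lemma op_linear_gauge_op: "op_linear (gauge_op a b p)"
  by (auto simp: op_linear_iff gauge_op_def qstate.scale_right_distrib mult.commute algebra_simps)

lemma gauge_op_hilbert:
  "p \<in> sites L \<Longrightarrow> \<psi> \<in> hilbert L \<Longrightarrow> gauge_op a b p \<psi> \<in> hilbert L"
  using subspace_hilbert support_subset unfolding gauge_op_def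
  by (intro qstate.subspace_add qstate.subspace_scale X_string_hilbert Z_string_hilbert) auto

text \<open>The product rule of a Clifford algebra on two anticommuting generators: inner product
  plus determinant times the product of the generators. A unit vector therefore gives an involution,
  and orthogonal vectors such as \<open>(a, b)\<close> and \<open>(b, - a)\<close> give
  anticommuting operators.\<close>

lemma gauge_op_same:
  assumes "p \<in> sites L"
  shows "gauge_op a b p (gauge_op c d p \<psi>) =
    cscale (a * c + b * d) \<psi> +
    cscale (a * d - b * c) (X_string (support L SW p) (Z_string (support L SE p) \<psi>))"
  using assms by (simp add: gauge_op_def Z_X_support) (simp add: cscale_def fun_eq_iff algebra_simps)

lemma gauge_op_involution:
  assumes "p \<in> sites L" "a * a + b * b = 1"
  shows "gauge_op a b p (gauge_op a b p \<psi>) = \<psi>"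
  using assms by (simp add: gauge_op_same mult.commute)

lemma gauge_op_anticommute:
  assumes "p \<in> sites L"
  shows "gauge_op a b p (gauge_op b (- a) p \<psi>) = - gauge_op b (- a) p (gauge_op a b p \<psi>)"
  using assms by (simp add: gauge_op_same cscale_def fun_eq_iff algebra_simps)

lemma gauge_op_commute:
  assumes "p \<in> sites L" "q \<in> sites L" "p \<noteq> q"
  shows "gauge_op a b p (gauge_op c d q \<psi>) = gauge_op c d q (gauge_op a b p \<psi>)"
  using assms
  by (simp add: gauge_op_def Z_X_support X_string_commute[of "support L SW p"]
      Z_string_commute[of "support L SE p"])
     (simp add: cscale_def fun_eq_iff algebra_simps)

lemma op_linear_stab: "p \<in> sites L \<Longrightarrow> op_linear (stab_X L p)" "p \<in> sites L \<Longrightarrow> op_linear (stab_Z L p)"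
  by (simp_all add: op_linear_iff stab_X_eq stab_Z_eq)

lemma stab_hilbert:
  assumes "p \<in> sites L" "\<psi> \<in> hilbert L"
  shows "stab_X L p \<psi> \<in> hilbert L" "stab_Z L p \<psi> \<in> hilbert L"
  using assms
  by (simp_all add: stab_X_eq stab_Z_eq X_string_hilbert Z_string_hilbert support_subset)

lemma stab_involution:
  assumes "p \<in> sites L"
  shows "stab_X L p (stab_X L p \<psi>) = \<psi>" "stab_Z L p (stab_Z L p \<psi>) = \<psi>"
  unfolding stab_X_eq[OF assms] stab_Z_eq[OF assms]
  by (subst X_string_commute[of "support L NE p" "support L SW p"], simp,
      subst Z_string_commute[of "support L NW p" "support L SE p"], simp)

lemma stab_string_commute:
  assumes "p \<in> sites L"
  shows "stab_X L p (X_string s \<psi>) = X_string s (stab_X L p \<psi>)"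
    "stab_Z L p (Z_string s \<psi>) = Z_string s (stab_Z L p \<psi>)"
  unfolding stab_X_eq[OF assms] stab_Z_eq[OF assms]
  using X_string_commute[of _ s] Z_string_commute[of _ s] by simp_all

text \<open>A stabilizer is a product of two triangles of one kind in a plaquette. A triangle of the
  other kind anticommutes with both or with neither, so the signs cancel.\<close>

lemma stab_support_commute:
  assumes "p \<in> sites L" "q \<in> sites L"
  shows "\<not> is_X d \<Longrightarrow> stab_X L p (Z_string (support L d q) \<psi>) = Z_string (support L d q) (stab_X L p \<psi>)"
    "is_X c \<Longrightarrow> stab_Z L p (X_string (support L c q) \<psi>) = X_string (support L c q) (stab_Z L p \<psi>)"
  using assms by (simp_all add: stab_X_eq stab_Z_eq Z_X_support)

lemma stab_gauge_op_commute:
  assumes "p \<in> sites L" "q \<in> sites L"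
  shows "stab_X L p (gauge_op a b q \<psi>) = gauge_op a b q (stab_X L p \<psi>)"
    "stab_Z L p (gauge_op a b q \<psi>) = gauge_op a b q (stab_Z L p \<psi>)"
  using assms
  by (simp_all add: gauge_op_def op_linearD[OF op_linear_stab(1)] op_linearD[OF op_linear_stab(2)]
      stab_string_commute stab_support_commute)

lemma stab_commute:
  assumes "p \<in> sites L" "q \<in> sites L"
  shows "stab_X L p (stab_X L q \<psi>) = stab_X L q (stab_X L p \<psi>)"
    "stab_Z L p (stab_Z L q \<psi>) = stab_Z L q (stab_Z L p \<psi>)"
    "stab_X L p (stab_Z L q \<psi>) = stab_Z L q (stab_X L p \<psi>)"
  using assms stab_X_eq[OF assms(2)] stab_Z_eq[OF assms(2)]
  by (simp_all add: stab_string_commute stab_support_commute)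

lemma stab_hamiltonian_commute:
  assumes "p \<in> sites L"
  shows "stab_X L p (hamiltonian L \<psi>) = hamiltonian L (stab_X L p \<psi>)"
    "stab_Z L p (hamiltonian L \<psi>) = hamiltonian L (stab_Z L p \<psi>)"
  using assms unfolding hamiltonian_eq
  by (simp_all add: op_linearD[OF op_linear_stab(1)] op_linearD[OF op_linear_stab(2)]
      stab_string_commute stab_support_commute cong: sum.cong)

lemma op_linear_hamiltonian: "op_linear (hamiltonian L)"
  unfolding op_linear_iff hamiltonian_eq
  by (simp add: sum.distrib qstate.scale_sum_right qstate.scale_right_distrib algebra_simps)

section \<open>The commuting family of generators and the operators that flip them\<close>

fun gen_op :: "(site \<Rightarrow> complex) \<Rightarrow> (site \<Rightarrow> complex) \<Rightarrow> generator \<Rightarrow> state \<Rightarrow> state" where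
  "gen_op a b (Gen_X p) = stab_X L p"
| "gen_op a b (Gen_Z p) = stab_Z L p"
| "gen_op a b (Gen_W p) = gauge_op (a p) (b p) p"

lemma gen_op_props:
  assumes "k \<in> generators (sites L) (sites L)"
  shows "op_linear (gen_op a b k)"
    "\<psi> \<in> hilbert L \<Longrightarrow> gen_op a b k \<psi> \<in> hilbert L"
    "(\<And>p. a p * a p + b p * b p = 1) \<Longrightarrow> gen_op a b k (gen_op a b k \<psi>) = \<psi>"
  using assms
  by (auto simp: generators_def op_linear_stab op_linear_gauge_op stab_hilbert gauge_op_hilbert
      stab_involution gauge_op_involution)

lemma gen_op_commute:
  assumes "j \<in> generators (sites L) (sites L)" "k \<in> generators (sites L) (sites L)"
  shows "gen_op a b j (gen_op a b k \<psi>) = gen_op a b k (gen_op a b j \<psi>)"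
proof -
  have W: "gauge_op (a p) (b p) p (gauge_op (a q) (b q) q \<psi>) =
      gauge_op (a q) (b q) q (gauge_op (a p) (b p) p \<psi>)" if "p \<in> sites L" "q \<in> sites L" for p q
    using gauge_op_commute that by (cases "p = q") auto
  show ?thesis
    using assms unfolding generators_def
    by (elim UnE imageE; simp only: gen_op.simps)
       (simp_all add: stab_commute stab_gauge_op_commute W)
qed

text \<open>W uses only the south-west and south-east triangles, so a stabilizer is flipped through
  its other factor: a Z string meets the north-east triangles oddly at \<open>p\<close> and at the
  origin, an X string does so for the north-west ones. The unwanted flip at the origin is harmless
  because \<open>K\<close> omits the origin stabilizers. W itself is flipped by the orthogonal
  combination of the same two triangles.\<close>

lemma flips_exist:
  assumes ab: "\<And>p. a p * a p + b p * b p = 1"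
  defines "K \<equiv> generators (sites L - {(0, 0)}) (sites L)"
  obtains U where "\<And>k. k \<in> K \<Longrightarrow> op_linear (U k)"
    "\<And>k \<psi>. k \<in> K \<Longrightarrow> \<psi> \<in> hilbert L \<Longrightarrow> U k \<psi> \<in> hilbert L"
    "\<And>k \<psi>. k \<in> K \<Longrightarrow> U k (U k \<psi>) = \<psi>"
    "\<And>j k \<psi>. j \<in> K \<Longrightarrow> k \<in> K \<Longrightarrow>
      gen_op a b j (U k \<psi>) = (if j = k then - U k (gen_op a b j \<psi>) else U k (gen_op a b j \<psi>))"
proof -
  have "\<exists>U. op_linear U \<and> (\<forall>\<psi>\<in>hilbert L. U \<psi> \<in> hilbert L) \<and> (\<forall>\<psi>. U (U \<psi>) = \<psi>) \<and>
      (\<forall>j\<in>K. \<forall>\<psi>. gen_op a b j (U \<psi>) =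
        (if j = k then - U (gen_op a b j \<psi>) else U (gen_op a b j \<psi>)))"
    if "k \<in> K" for k
  proof (cases k)
    case (Gen_X p)
    then have p: "p \<in> sites L" "p \<noteq> (0, 0)"
      using that by (auto simp: K_def generators_def)
    obtain c where c: "c \<subseteq> qubits L" "\<And>q. q \<in> sites L \<Longrightarrow> even (card (c \<inter> support L SW q))"
      "\<And>q. q \<in> sites L \<Longrightarrow> odd (card (c \<inter> support L NE q)) \<longleftrightarrow> (q = p) \<noteq> (q = (0, 0))"
      using path_flip[OF p(1), of SW NE] by blast
    have fin: "finite c"
      using c(1) finite_qubits finite_subset by blast
    have SW: "X_string (support L SW q) (Z_string c \<psi>) = Z_string c (X_string (support L SW q) \<psi>)"
      if "q \<in> sites L" for q \<psi>
      using c(2)[OF that] X_string_Z_string[OF fin] by (simp add: Int_commute)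
    have NE: "X_string (support L NE q) (Z_string c \<psi>) = (if (q = p) \<noteq> (q = (0, 0))
        then - Z_string c (X_string (support L NE q) \<psi>) else Z_string c (X_string (support L NE q) \<psi>))"
      if "q \<in> sites L" for q \<psi>
      using c(3)[OF that] X_string_Z_string[OF fin] by (simp add: Int_commute)
    have "gen_op a b j (Z_string c \<psi>) =
        (if j = k then - Z_string c (gen_op a b j \<psi>) else Z_string c (gen_op a b j \<psi>))"
      if "j \<in> K" for j \<psi>
      using that Gen_X p unfolding K_def generators_def
      by (elim UnE imageE)
         (auto simp: stab_X_eq SW NE stab_string_commute gauge_op_def Z_string_commute)
    then show ?thesis
      using op_linear_Z_string Z_string_hilbert by (intro exI[of _ "Z_string c"]) auto
  next
    case (Gen_Z p)
    then have p: "p \<in> sites L" "p \<noteq> (0, 0)"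
      using that by (auto simp: K_def generators_def)
    obtain c where c: "c \<subseteq> qubits L" "\<And>q. q \<in> sites L \<Longrightarrow> even (card (c \<inter> support L SE q))"
      "\<And>q. q \<in> sites L \<Longrightarrow> odd (card (c \<inter> support L NW q)) \<longleftrightarrow> (q = p) \<noteq> (q = (0, 0))"
      using path_flip[OF p(1), of SE NW] by blast
    have SE: "Z_string (support L SE q) (X_string c \<psi>) = X_string c (Z_string (support L SE q) \<psi>)"
      if "q \<in> sites L" for q \<psi>
      using c(2)[OF that] Z_string_X_string[OF finite_support] by simp
    have NW: "Z_string (support L NW q) (X_string c \<psi>) = (if (q = p) \<noteq> (q = (0, 0))
        then - X_string c (Z_string (support L NW q) \<psi>) else X_string c (Z_string (support L NW q) \<psi>))"
      if "q \<in> sites L" for q \<psi>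
      using c(3)[OF that] Z_string_X_string[OF finite_support] by simp
    have "gen_op a b j (X_string c \<psi>) =
        (if j = k then - X_string c (gen_op a b j \<psi>) else X_string c (gen_op a b j \<psi>))"
      if "j \<in> K" for j \<psi>
      using that Gen_Z p unfolding K_def generators_def
      by (elim UnE imageE)
         (auto simp: stab_Z_eq SE NW stab_string_commute gauge_op_def X_string_commute)
    then show ?thesis
      using op_linear_X_string X_string_hilbert[OF c(1)] by (intro exI[of _ "X_string c"]) auto
  next
    case (Gen_W p)
    then have p: "p \<in> sites L"
      using that by (auto simp: K_def generators_def)
    have "b p * b p + - a p * - a p = 1"
      using ab[of p] by (simp add: add.commute)
    moreover have "gen_op a b j (gauge_op (b p) (- a p) p \<psi>) =
        (if j = k then - gauge_op (b p) (- a p) p (gen_op a b j \<psi>)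
         else gauge_op (b p) (- a p) p (gen_op a b j \<psi>))"
      if "j \<in> K" for j \<psi>
      using that Gen_W p gauge_op_commute gauge_op_anticommute[OF p] unfolding K_def generators_def
      by (elim UnE imageE) (auto simp: stab_gauge_op_commute)
    ultimately show ?thesis
      using op_linear_gauge_op gauge_op_hilbert[OF p] gauge_op_involution[OF p]
      by (intro exI[of _ "gauge_op (b p) (- a p) p"]) auto
  qed
  then have "\<forall>k\<in>K. \<exists>U. op_linear U \<and> (\<forall>\<psi>\<in>hilbert L. U \<psi> \<in> hilbert L) \<and> (\<forall>\<psi>. U (U \<psi>) = \<psi>) \<and>
      (\<forall>j\<in>K. \<forall>\<psi>. gen_op a b j (U \<psi>) =
        (if j = k then - U (gen_op a b j \<psi>) else U (gen_op a b j \<psi>)))" ..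
  from bchoice[OF this] obtain U where U: "\<forall>k\<in>K. op_linear (U k) \<and> (\<forall>\<psi>\<in>hilbert L. U k \<psi> \<in> hilbert L) \<and>
      (\<forall>\<psi>. U k (U k \<psi>) = \<psi>) \<and> (\<forall>j\<in>K. \<forall>\<psi>. gen_op a b j (U k \<psi>) =
        (if j = k then - U k (gen_op a b j \<psi>) else U k (gen_op a b j \<psi>)))" ..
  show ?thesis
    by (rule that[of U]) (use U in simp_all)
qed

end

section \<open>Joint eigenspaces\<close>

text \<open>
  For \<open>\<epsilon> x z = 0\<close> any involution serves as the plaquette operator; \<open>coef_Z x z\<close> is then \<open>0\<close>
  (division by zero), which matches \<open>coef_X x z = 1\<close>.
\<close>

definition coef_X :: "real \<Rightarrow> real \<Rightarrow> real" where
  "coef_X x z = (if \<epsilon> x z = 0 then 1 else (1 + x) / \<epsilon> x z)"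

definition coef_Z :: "real \<Rightarrow> real \<Rightarrow> real" where
  "coef_Z x z = (1 + z) / \<epsilon> x z"

lemma epsilon_square: "\<epsilon> x z * \<epsilon> x z = (1 + x)\<^sup>2 + (1 + z)\<^sup>2"
  by (simp add: \<epsilon>_def)

text \<open>If the root vanishes, so do both squares under it; the equations thus survive the
  degenerate case.\<close>

lemma epsilon_coef:
  "\<epsilon> x z * coef_X x z = 1 + x" "\<epsilon> x z * coef_Z x z = 1 + z"
  using epsilon_square[of x z] sum_power2_eq_zero_iff[of "1 + x" "1 + z"]
  by (auto simp: coef_X_def coef_Z_def)

lemma coef_square: "coef_X x z * coef_X x z + coef_Z x z * coef_Z x z = 1"
proof (cases "\<epsilon> x z = 0")
  case False
  have "(1 + x) * (1 + x) + (1 + z) * (1 + z) = \<epsilon> x z * \<epsilon> x z"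
    using epsilon_square[of x z] by (simp add: power2_eq_square)
  then show ?thesis
    using False by (simp add: coef_X_def coef_Z_def flip: add_divide_distrib)
qed (simp add: coef_X_def coef_Z_def)

context torus
begin

text \<open>The syndromes enter as numbers, not as operators: this is an involution on the whole
  space, tied to H only on \<open>sector L x z\<close>.\<close>

definition plaquette_op :: "(site \<Rightarrow> real) \<Rightarrow> (site \<Rightarrow> real) \<Rightarrow> site \<Rightarrow> state \<Rightarrow> state" where
  "plaquette_op x z p = gauge_op (of_real (coef_X (x p) (z p))) (of_real (coef_Z (x p) (z p))) p"

lemma plaquette_op_square:
  "complex_of_real (coef_X x z) * complex_of_real (coef_X x z) +
   complex_of_real (coef_Z x z) * complex_of_real (coef_Z x z) = 1"
  using coef_square[of x z] by (metis of_real_1 of_real_add of_real_mult)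

lemma hamiltonian_sector:
  assumes "\<psi> \<in> sector L x z"
  shows "hamiltonian L \<psi> =
    - (\<Sum>p\<in>sites L. cscale (of_real (\<epsilon> (x p) (z p))) (plaquette_op x z p \<psi>))"
proof -
  have "X_string (support L SW p) \<psi> + X_string (support L NE p) \<psi> +
      (Z_string (support L SE p) \<psi> + Z_string (support L NW p) \<psi>) =
      cscale (of_real (\<epsilon> (x p) (z p))) (plaquette_op x z p \<psi>)" if p: "p \<in> sites L" for p
  proof -
    have "stab_X L p \<psi> = cscale (of_real (x p)) \<psi>" "stab_Z L p \<psi> = cscale (of_real (z p)) \<psi>"
      using assms p by (auto simp: sector_def)
    \<comment> \<open>Applying the south-west (south-east) involution to the stabilizer equation
      expresses the opposite triangle by the one that occurs in W.\<close>
    then have NE: "X_string (support L NE p) \<psi> = cscale (of_real (x p)) (X_string (support L SW p) \<psi>)"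
      and NW: "Z_string (support L NW p) \<psi> = cscale (of_real (z p)) (Z_string (support L SE p) \<psi>)"
      using stab_X_eq[OF p, of \<psi>] stab_Z_eq[OF p, of \<psi>]
      by (metis X_string_involution string_linear(2), metis Z_string_involution string_linear(8))
    show ?thesis
      unfolding NE NW plaquette_op_def gauge_op_def qstate.scale_right_distrib qstate.scale_scale
        of_real_mult[symmetric] epsilon_coef
      by (simp add: qstate.scale_left_distrib)
  qed
  then show ?thesis
    unfolding hamiltonian_eq by simp
qed

lemma subspace_sector: "qstate.subspace (sector L x z)"
  using subspace_hilbert[of L] unfolding qstate.subspace_def sector_def
  by (auto simp: op_linearD[OF op_linear_stab(1)] op_linearD[OF op_linear_stab(2)]
      qstate.scale_right_distrib qstate.scale_left_commute)

lemma prod_syndrome_X: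
  assumes "\<psi> \<noteq> 0" "\<And>p. p \<in> sites L \<Longrightarrow> stab_X L p \<psi> = cscale (of_real (x p)) \<psi>"
  shows "(\<Prod>p\<in>sites L. x p) = 1"
proof -
  have "(\<Prod>p\<in>sites L. complex_of_real (x p)) = 1"
    by (rule prod_syndrome[where R = X_string and c = SW and d = NE and \<psi> = \<psi>])
       (use assms in \<open>auto simp: op_linear_X_string X_string_Un simp flip: stab_X_eq intro: X_string_commute\<close>)
  then show ?thesis
    by (metis of_real_1 of_real_eq_iff of_real_prod)
qed

lemma prod_syndrome_Z:
  assumes "\<psi> \<noteq> 0" "\<And>p. p \<in> sites L \<Longrightarrow> stab_Z L p \<psi> = cscale (of_real (z p)) \<psi>"
  shows "(\<Prod>p\<in>sites L. z p) = 1"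
proof -
  have "(\<Prod>p\<in>sites L. complex_of_real (z p)) = 1"
    by (rule prod_syndrome[where R = Z_string and c = SE and d = NW and \<psi> = \<psi>])
       (use assms in \<open>auto simp: op_linear_Z_string Z_string_Un simp flip: stab_Z_eq intro: Z_string_commute\<close>)
  then show ?thesis
    by (metis of_real_1 of_real_eq_iff of_real_prod)
qed

text \<open>
  The constraint \<open>\<Prod>p. x p = 1\<close> determines the syndrome at the origin from all the others: the
  component of \<open>\<psi>\<close> with the opposite value there would violate it.
\<close>

lemma syndrome_at_origin:
  assumes S: "\<And>p. p \<in> sites L \<Longrightarrow> op_linear (S p)"
      "\<And>p \<phi>. p \<in> sites L \<Longrightarrow> S p (S p \<phi>) = \<phi>"
      "\<And>p q \<phi>. p \<in> sites L \<Longrightarrow> q \<in> sites L \<Longrightarrow> S p (S q \<phi>) = S q (S p \<phi>)"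
    and prod: "\<And>\<phi> y. \<phi> \<noteq> 0 \<Longrightarrow> (\<And>p. p \<in> sites L \<Longrightarrow> S p \<phi> = cscale (of_real (y p)) \<phi>) \<Longrightarrow>
      (\<Prod>p\<in>sites L. y p) = (1 :: real)"
    and x: "x \<in> syndromes L"
    and \<psi>: "\<And>p. p \<in> sites L - {(0, 0)} \<Longrightarrow> S p \<psi> = cscale (of_real (x p)) \<psi>"
  shows "S (0, 0) \<psi> = cscale (of_real (x (0, 0))) \<psi>"
proof (rule ccontr)
  let ?o = "(0, 0) :: site"
  note o = origin_in_sites
  note lin = op_linearD[OF S(1)]
  have xo: "complex_of_real (x ?o) * complex_of_real (x ?o) = 1"
    using x o by (auto simp: syndromes_def signs_def Pi_iff dest!: bspec[of _ _ ?o])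
  assume neq: "S ?o \<psi> \<noteq> cscale (of_real (x ?o)) \<psi>"
  define \<phi> where "\<phi> = S ?o \<psi> - cscale (of_real (x ?o)) \<psi>"
  define y where "y = x(?o := - x ?o)"
  have "\<phi> \<noteq> 0" using neq by (simp add: \<phi>_def)
  moreover have "S p \<phi> = cscale (of_real (y p)) \<phi>" if p: "p \<in> sites L" for p
  proof (cases "p = ?o")
    case True
    then show ?thesis
      using S(2)[OF o] xo
      by (simp add: \<phi>_def y_def lin[OF o] qstate.scale_right_diff_distrib)
  next
    case False
    then have "S p \<psi> = cscale (of_real (x p)) \<psi>" using \<psi> p by simp
    then show ?thesis
      using False S(3)[OF p o, of \<psi>]
      by (simp add: \<phi>_def y_def lin[OF o] lin[OF p] qstate.scale_right_diff_distrib mult.commute)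
  qed
  ultimately have "(\<Prod>p\<in>sites L. y p) = 1" by (rule prod)
  moreover have "(\<Prod>p\<in>sites L. y p) = - (\<Prod>p\<in>sites L. x p)"
  proof -
    have "(\<Prod>p\<in>sites L - {?o}. y p) = (\<Prod>p\<in>sites L - {?o}. x p)"
      by (rule prod.cong) (auto simp: y_def)
    then show ?thesis
      using prod.remove[OF finite_sites o, of y] prod.remove[OF finite_sites o, of x]
      by (simp add: y_def)
  qed
  ultimately show False
    using x by (simp add: syndromes_def)
qed

definition joint_eigenspace :: "(site \<Rightarrow> real) \<Rightarrow> (site \<Rightarrow> real) \<Rightarrow> (site \<Rightarrow> real) \<Rightarrow> state set" where
  "joint_eigenspace x z s =
    {\<psi> \<in> sector L x z. \<forall>p\<in>sites L. plaquette_op x z p \<psi> = cscale (of_real (s p)) \<psi>}"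

lemma card_generators: "card (generators (sites L - {(0, 0)}) (sites L)) + 2 = 3 * L\<^sup>2"
proof -
  let ?P = "sites L - {(0, 0)}"
  have "card (generators ?P (sites L)) = card ?P + card ?P + card (sites L)"
    unfolding generators_def using finite_sites
    by (subst card_Un_disjoint; (subst card_Un_disjoint)?; auto simp: card_image inj_on_def)
  moreover have "card ?P + 1 = card (sites L)"
    using origin_in_sites finite_sites by (metis card_Suc_Diff1 Suc_eq_plus1)
  ultimately show ?thesis by (simp add: card_sites)
qed

lemma dim_joint_eigenspace:
  assumes x: "x \<in> syndromes L" and z: "z \<in> syndromes L" and s: "s \<in> signs L"
  shows "qstate.dim (joint_eigenspace x z s) = 4"
proof -
  define a where "a p = complex_of_real (coef_X (x p) (z p))" for p
  define b where "b p = complex_of_real (coef_Z (x p) (z p))" for p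
  have ab: "a p * a p + b p * b p = 1" for p
    unfolding a_def b_def by (rule plaquette_op_square)
  define K where "K = generators (sites L - {(0, 0)}) (sites L)"
  have KK: "k \<in> generators (sites L) (sites L)" if "k \<in> K" for k
    using that by (auto simp: K_def generators_def)
  have finK: "finite K"
    by (simp add: K_def generators_def finite_sites)
  define sgn :: "generator \<Rightarrow> complex" where
    "sgn k = of_real (case k of Gen_X p \<Rightarrow> x p | Gen_Z p \<Rightarrow> z p | Gen_W p \<Rightarrow> s p)" for k
  have sgn: "sgn k * sgn k = 1" if "k \<in> K" for k
    using that x z s unfolding K_def generators_def syndromes_def signs_def Pi_iff sgn_def
    by auto
  obtain U where U: "\<And>k. k \<in> K \<Longrightarrow> op_linear (U k)"
    "\<And>k \<psi>. k \<in> K \<Longrightarrow> \<psi> \<in> hilbert L \<Longrightarrow> U k \<psi> \<in> hilbert L"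
    "\<And>k \<psi>. k \<in> K \<Longrightarrow> U k (U k \<psi>) = \<psi>"
    "\<And>j k \<psi>. j \<in> K \<Longrightarrow> k \<in> K \<Longrightarrow>
      gen_op a b j (U k \<psi>) = (if j = k then - U k (gen_op a b j \<psi>) else U k (gen_op a b j \<psi>))"
    by (rule flips_exist[of a b, OF ab, folded K_def]) (rule that; assumption)
  have "qstate.dim (hilbert L) =
    2 ^ card K * qstate.dim {\<psi> \<in> hilbert L. \<forall>k\<in>K. gen_op a b k \<psi> = cscale (sgn k) \<psi>}"
    by (rule qstate.dim_joint_eigenspace[where U = U, OF finK subspace_hilbert
          basis_hilbert(5) basis_hilbert(1)])
       (use KK gen_op_props ab gen_op_commute U sgn in auto)
  \<comment> \<open>\<open>K\<close> omits the two stabilizers at the origin; their eigenvalues are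
    forced by the product constraint on \<open>x\<close> and \<open>z\<close>.\<close>
  moreover have "{\<psi> \<in> hilbert L. \<forall>k\<in>K. gen_op a b k \<psi> = cscale (sgn k) \<psi>} = joint_eigenspace x z s"
  proof (intro set_eqI iffI)
    fix \<psi> assume "\<psi> \<in> {\<psi> \<in> hilbert L. \<forall>k\<in>K. gen_op a b k \<psi> = cscale (sgn k) \<psi>}"
    then have \<psi>: "\<psi> \<in> hilbert L" and k: "\<And>k. k \<in> K \<Longrightarrow> gen_op a b k \<psi> = cscale (sgn k) \<psi>"
      by auto
    have X: "stab_X L p \<psi> = cscale (of_real (x p)) \<psi>"
      and Z: "stab_Z L p \<psi> = cscale (of_real (z p)) \<psi>" if "p \<in> sites L - {(0, 0)}" for p
      using k[of "Gen_X p"] k[of "Gen_Z p"] that by (auto simp: K_def generators_def sgn_def)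
    have W: "plaquette_op x z p \<psi> = cscale (of_real (s p)) \<psi>" if "p \<in> sites L" for p
      using k[of "Gen_W p"] that
      by (auto simp: K_def generators_def sgn_def plaquette_op_def a_def b_def)
    have "stab_X L (0, 0) \<psi> = cscale (of_real (x (0, 0))) \<psi>"
      by (rule syndrome_at_origin[of "stab_X L"])
         (use prod_syndrome_X op_linear_stab stab_involution stab_commute x X in auto)
    moreover have "stab_Z L (0, 0) \<psi> = cscale (of_real (z (0, 0))) \<psi>"
      by (rule syndrome_at_origin[of "stab_Z L"])
         (use prod_syndrome_Z op_linear_stab stab_involution stab_commute z Z in auto)
    ultimately have "\<psi> \<in> sector L x z"
      unfolding sector_def using \<psi> X Z by blast
    then show "\<psi> \<in> joint_eigenspace x z s"
      using W by (simp add: joint_eigenspace_def)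
  next
    fix \<psi> assume "\<psi> \<in> joint_eigenspace x z s"
    then show "\<psi> \<in> {\<psi> \<in> hilbert L. \<forall>k\<in>K. gen_op a b k \<psi> = cscale (sgn k) \<psi>}"
      by (auto simp: joint_eigenspace_def sector_def K_def generators_def sgn_def plaquette_op_def
          a_def b_def)
  qed
  ultimately have "2 ^ (card K + 2) = 2 ^ card K * qstate.dim (joint_eigenspace x z s)"
    using dim_hilbert card_generators K_def by simp
  then show ?thesis by (simp add: power_add)
qed

lemma joint_eigenspace_nontrivial:
  assumes "x \<in> syndromes L" "z \<in> syndromes L" "s \<in> signs L"
  obtains \<psi> where "\<psi> \<in> joint_eigenspace x z s" "\<psi> \<noteq> 0"
proof -
  have "\<not> joint_eigenspace x z s \<subseteq> {0}"
  proof
    assume "joint_eigenspace x z s \<subseteq> {0}"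
    then have "qstate.dim (joint_eigenspace x z s) \<le> card ({} :: state set)"
      by (intro qstate.dim_le_card) auto
    then show False
      using dim_joint_eigenspace[OF assms] by simp
  qed
  then show ?thesis using that by blast
qed

text \<open>Owing to the minus sign in H, the sign \<sigma> of a plaquette in the spectrum is minus
  the eigenvalue of its W.\<close>

lemma hamiltonian_joint_eigenspace:
  assumes "\<psi> \<in> joint_eigenspace x z s"
  shows "hamiltonian L \<psi> = cscale (of_real (\<Sum>p\<in>sites L. - s p * \<epsilon> (x p) (z p))) \<psi>"
proof -
  have "hamiltonian L \<psi> =
      - (\<Sum>p\<in>sites L. cscale (of_real (\<epsilon> (x p) (z p))) (cscale (of_real (s p)) \<psi>))"
    using assms hamiltonian_sector[of \<psi> x z] by (simp add: joint_eigenspace_def cong: sum.cong)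
  also have "\<dots> = cscale (of_real (\<Sum>p\<in>sites L. - s p * \<epsilon> (x p) (z p))) \<psi>"
    by (simp add: qstate.scale_sum_left sum_negf mult.commute)
  finally show ?thesis .
qed

text \<open>Stated for any stable \<open>V\<close> so that the vector found still lies in a
  prescribed eigenspace of H, or in the part of it where one stabilizer is -1.\<close>

lemma exists_sector:
  assumes V: "qstate.subspace V" "V \<subseteq> hilbert L" "\<psi> \<in> V" "\<psi> \<noteq> 0"
    and inv: "\<And>p \<psi>. p \<in> sites L \<Longrightarrow> \<psi> \<in> V \<Longrightarrow> stab_X L p \<psi> \<in> V \<and> stab_Z L p \<psi> \<in> V"
  obtains x z \<phi> where "x \<in> syndromes L" "z \<in> syndromes L" "\<phi> \<in> V" "\<phi> \<in> sector L x z" "\<phi> \<noteq> 0"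
proof -
  define K where "K = generators (sites L) {}"
  have KK: "k \<in> generators (sites L) (sites L)" if "k \<in> K" for k
    using that by (auto simp: K_def generators_def)
  \<comment> \<open>The family contains only stabilizers; the constants 1 and 0 are simply a pair
    that satisfies the normalisation in \<open>gen_op_props\<close>.\<close>
  have KV: "gen_op (\<lambda>_. 1) (\<lambda>_. 0) k \<phi> \<in> V" if "k \<in> K" "\<phi> \<in> V" for k \<phi>
    using that inv by (auto simp: K_def generators_def)
  have finK: "finite K"
    by (simp add: K_def generators_def finite_sites)
  obtain s \<phi> where \<phi>: "\<phi> \<in> V" "\<phi> \<noteq> 0" and s: "\<And>k. k \<in> K \<Longrightarrow> s k \<in> {1, -1}"
    "\<And>k. k \<in> K \<Longrightarrow> gen_op (\<lambda>_. 1) (\<lambda>_. 0) k \<phi> = cscale (s k) \<phi>"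
    by (rule qstate.joint_eigenvector[OF finK V(1,3,4), of "gen_op (\<lambda>_. 1) (\<lambda>_. 0)"])
       (use KK KV gen_op_props gen_op_commute in auto)
  define x where "x p = Re (s (Gen_X p))" for p
  define z where "z p = Re (s (Gen_Z p))" for p
  have s': "s k = of_real (Re (s k))" "Re (s k) \<in> {1, -1}" if "k \<in> K" for k
    using s(1)[OF that] by auto
  have K: "Gen_X p \<in> K" "Gen_Z p \<in> K" if "p \<in> sites L" for p
    using that by (auto simp: K_def generators_def)
  have sec: "stab_X L p \<phi> = cscale (of_real (x p)) \<phi>" "stab_Z L p \<phi> = cscale (of_real (z p)) \<phi>"
    if "p \<in> sites L" for p
    using s(2)[OF K(1)[OF that]] s(2)[OF K(2)[OF that]] s'(1)[OF K(1)[OF that]] s'(1)[OF K(2)[OF that]]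
    unfolding x_def z_def by simp_all
  have "x \<in> syndromes L" "z \<in> syndromes L"
    using prod_syndrome_X[OF \<phi>(2), of x] prod_syndrome_Z[OF \<phi>(2), of z] sec s'(2) K
    unfolding syndromes_def signs_def x_def z_def by auto
  moreover have "\<phi> \<in> sector L x z"
    using sec \<phi>(1) V(2) by (auto simp: sector_def)
  ultimately show ?thesis using that \<phi> by blast
qed

lemma plaquette_op_sector:
  assumes "p \<in> sites L" "\<psi> \<in> sector L x z"
  shows "plaquette_op x z p \<psi> \<in> sector L x z"
proof -
  have "gauge_op a b p \<psi> \<in> sector L x z" for a b
    using assms op_linearD(2)[OF op_linear_gauge_op]
    unfolding sector_def by (auto simp: gauge_op_hilbert stab_gauge_op_commute)
  then show ?thesis by (simp add: plaquette_op_def)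
qed

text \<open>Inside the sector H is a combination of the mutually commuting plaquette operators. The
  sector formula is used at \<psi> and at its image, which stays in the sector.\<close>

lemma hamiltonian_plaquette_op:
  assumes p: "p \<in> sites L" and \<psi>: "\<psi> \<in> sector L x z"
  shows "hamiltonian L (plaquette_op x z p \<psi>) = plaquette_op x z p (hamiltonian L \<psi>)"
proof -
  have lin: "op_linear (plaquette_op x z p)"
    unfolding plaquette_op_def by (rule op_linear_gauge_op)
  have comm: "plaquette_op x z q (plaquette_op x z p \<phi>) = plaquette_op x z p (plaquette_op x z q \<phi>)"
    if "q \<in> sites L" for q \<phi>
    using gauge_op_commute[OF that p] unfolding plaquette_op_def by (cases "q = p") auto
  show ?thesis
    unfolding hamiltonian_sector[OF \<psi>] hamiltonian_sector[OF plaquette_op_sector[OF p \<psi>]]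
    by (simp add: op_linearD[OF lin] comm cong: sum.cong)
qed

lemma exists_joint_eigenvector:
  assumes V: "qstate.subspace V" "V \<subseteq> sector L x z" "\<psi> \<in> V" "\<psi> \<noteq> 0"
    and inv: "\<And>p \<psi>. p \<in> sites L \<Longrightarrow> \<psi> \<in> V \<Longrightarrow> plaquette_op x z p \<psi> \<in> V"
  obtains s \<phi> where "s \<in> signs L" "\<phi> \<in> V" "\<phi> \<in> joint_eigenspace x z s" "\<phi> \<noteq> 0"
proof -
  define a where "a p = complex_of_real (coef_X (x p) (z p))" for p
  define b where "b p = complex_of_real (coef_Z (x p) (z p))" for p
  have ab: "a p * a p + b p * b p = 1" for p
    unfolding a_def b_def by (rule plaquette_op_square)
  define K where "K = generators {} (sites L)"
  have W: "gen_op a b (Gen_W p) = plaquette_op x z p" for p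
    by (simp add: plaquette_op_def a_def b_def)
  have KK: "k \<in> generators (sites L) (sites L)" if "k \<in> K" for k
    using that by (auto simp: K_def generators_def)
  have KV: "gen_op a b k \<phi> \<in> V" if "k \<in> K" "\<phi> \<in> V" for k \<phi>
    using that inv unfolding K_def generators_def by (auto simp del: gen_op.simps simp: W)
  have finK: "finite K"
    by (simp add: K_def generators_def finite_sites)
  obtain t \<phi> where \<phi>: "\<phi> \<in> V" "\<phi> \<noteq> 0" and t: "\<And>k. k \<in> K \<Longrightarrow> t k \<in> {1, -1}"
    "\<And>k. k \<in> K \<Longrightarrow> gen_op a b k \<phi> = cscale (t k) \<phi>"
    by (rule qstate.joint_eigenvector[OF finK V(1,3,4), of "gen_op a b"])
       (use KK KV gen_op_props gen_op_commute ab in auto)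
  define s where "s p = Re (t (Gen_W p))" for p
  have K: "Gen_W p \<in> K" if "p \<in> sites L" for p
    using that by (auto simp: K_def generators_def)
  have t': "t k = of_real (Re (t k))" "Re (t k) \<in> {1, -1}" if "k \<in> K" for k
    using t(1)[OF that] by auto
  have "plaquette_op x z p \<phi> = cscale (of_real (s p)) \<phi>" if "p \<in> sites L" for p
    using t(2)[OF K[OF that]] t'(1)[OF K[OF that]] unfolding s_def W by simp
  then have "\<phi> \<in> joint_eigenspace x z s"
    using \<phi> V(2) by (auto simp: joint_eigenspace_def)
  moreover have "s \<in> signs L"
    using t'(2) K by (auto simp: signs_def s_def)
  ultimately show ?thesis using that \<phi> by blast
qed

end

section \<open>Energies\<close>

lemma epsilon_values:
  "\<epsilon> 1 1 = 2 * sqrt 2" "\<epsilon> 1 (- 1) = 2" "\<epsilon> (- 1) 1 = 2" "\<epsilon> (- 1) (- 1) = 0"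
  using real_sqrt_mult[of 4 2] by (simp_all add: \<epsilon>_def)

definition energy :: "nat \<Rightarrow> (site \<Rightarrow> real) \<Rightarrow> (site \<Rightarrow> real) \<Rightarrow> (site \<Rightarrow> real) \<Rightarrow> real" where
  "energy L \<sigma> x z = (\<Sum>p\<in>sites L. \<sigma> p * \<epsilon> (x p) (z p))"

text \<open>The energy of a plaquette above its minimum, \<open>- 2 * sqrt 2\<close>. As excesses
  are nonnegative, a lower bound on the total needs only a few chosen plaquettes.\<close>

definition excess :: "(site \<Rightarrow> real) \<Rightarrow> (site \<Rightarrow> real) \<Rightarrow> (site \<Rightarrow> real) \<Rightarrow> site \<Rightarrow> real" where
  "excess \<sigma> x z p = \<sigma> p * \<epsilon> (x p) (z p) + 2 * sqrt 2"

lemma energy_excess: "energy L \<sigma> x z = - 2 * sqrt 2 * (real L)\<^sup>2 + (\<Sum>p\<in>sites L. excess \<sigma> x z p)"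
  by (simp add: energy_def excess_def sum.distrib card_sites)

lemma one_less_sqrt_2: "1 < sqrt (2 :: real)"
  by simp

text \<open>The bound for a defect is attained when \<sigma> is -1 and exactly one of the two
  syndromes is -1; with both equal to -1 the plaquette contributes 0 and the excess is
  \<open>2 * sqrt 2\<close>.\<close>

lemma excess_bounds:
  assumes "\<sigma> \<in> signs L" "x \<in> signs L" "z \<in> signs L" "p \<in> sites L"
  shows "0 \<le> excess \<sigma> x z p"
    "x p = -1 \<or> z p = -1 \<Longrightarrow> 2 * sqrt 2 - 2 \<le> excess \<sigma> x z p"
    "x p = 1 \<Longrightarrow> z p = 1 \<Longrightarrow> \<sigma> p = 1 \<Longrightarrow> excess \<sigma> x z p = 4 * sqrt 2"
proof -
  have "\<sigma> p \<in> {1, -1}" "x p \<in> {1, -1}" "z p \<in> {1, -1}"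
    using assms by (auto simp: signs_def)
  then show "0 \<le> excess \<sigma> x z p"
    "x p = -1 \<or> z p = -1 \<Longrightarrow> 2 * sqrt 2 - 2 \<le> excess \<sigma> x z p"
    "x p = 1 \<Longrightarrow> z p = 1 \<Longrightarrow> \<sigma> p = 1 \<Longrightarrow> excess \<sigma> x z p = 4 * sqrt 2"
    using one_less_sqrt_2 by (auto simp: excess_def epsilon_values)
qed

lemma sum_excess_ge:
  assumes "\<sigma> \<in> signs L" "x \<in> signs L" "z \<in> signs L" "P \<subseteq> sites L"
  shows "(\<Sum>p\<in>P. excess \<sigma> x z p) \<le> (\<Sum>p\<in>sites L. excess \<sigma> x z p)"
  using assms excess_bounds(1)[OF assms(1-3)] by (intro sum_mono2) (auto simp: finite_sites)

lemma energy_ge: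
  assumes "\<sigma> \<in> signs L" "x \<in> signs L" "z \<in> signs L"
  shows "- 2 * sqrt 2 * (real L)\<^sup>2 \<le> energy L \<sigma> x z"
  using sum_excess_ge[OF assms, of "{}"] energy_excess[of L \<sigma> x z] by simp

text \<open>A single -1 would make the product -1. This parity is what doubles the cost of a
  defect.\<close>

lemma syndrome_defects_pair:
  assumes "x \<in> syndromes L" "p \<in> sites L" "x p = -1"
  obtains q where "q \<in> sites L" "q \<noteq> p" "x q = -1"
proof -
  have "\<exists>q\<in>sites L - {p}. x q \<noteq> 1"
  proof (rule ccontr)
    assume "\<not> ?thesis"
    then have "(\<Prod>q\<in>sites L - {p}. x q) = 1" by (intro prod.neutral) auto
    then have "(\<Prod>q\<in>sites L. x q) = -1"
      using prod.remove[OF finite_sites assms(2), of x] assms(3) by simp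
    then show False using assms(1) by (simp add: syndromes_def)
  qed
  then obtain q where "q \<in> sites L" "q \<noteq> p" "x q \<noteq> 1" by blast
  moreover have "x q \<in> {1, -1}"
    using assms(1) \<open>q \<in> sites L\<close> by (auto simp: syndromes_def signs_def)
  ultimately show ?thesis using that by auto
qed

text \<open>Either there is a defect, hence a second one of the same kind elsewhere, and the excess
  is at least \<open>2 * (2 * sqrt 2 - 2)\<close>; or there is none and some W is reversed, at the
  larger cost \<open>4 * sqrt 2\<close>.\<close>

lemma energy_gap_ge:
  assumes \<sigma>: "\<sigma> \<in> signs L" and x: "x \<in> syndromes L" and z: "z \<in> syndromes L"
    and exc: "\<exists>p\<in>sites L. x p = -1 \<or> z p = -1 \<or> \<sigma> p = 1"
  shows "- 2 * sqrt 2 * (real L)\<^sup>2 + 4 * (sqrt 2 - 1) \<le> energy L \<sigma> x z"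
proof -
  have xz: "x \<in> signs L" "z \<in> signs L"
    using x z by (auto simp: syndromes_def)
  have two: ?thesis
    if "p \<in> sites L" "q \<in> sites L" "q \<noteq> p" "x p = -1 \<or> z p = -1" "x q = -1 \<or> z q = -1" for p q
    using sum_excess_ge[OF \<sigma> xz, of "{p, q}"] excess_bounds(2)[OF \<sigma> xz that(1,4)]
      excess_bounds(2)[OF \<sigma> xz that(2,5)] that energy_excess[of L \<sigma> x z] by simp
  show ?thesis
  proof (cases "\<exists>p\<in>sites L. x p = -1 \<or> z p = -1")
    case True
    then obtain p where p: "p \<in> sites L" "x p = -1 \<or> z p = -1" by blast
    then obtain q where "q \<in> sites L" "q \<noteq> p" "x q = -1 \<or> z q = -1"
      using syndrome_defects_pair[OF x p(1)] syndrome_defects_pair[OF z p(1)] by metis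
    then show ?thesis using two p by blast
  next
    case False
    then obtain p where p: "p \<in> sites L" "\<sigma> p = 1" using exc by blast
    then have "x p = 1" "z p = 1"
      using False xz by (auto simp: signs_def Pi_iff)
    then show ?thesis
      using sum_excess_ge[OF \<sigma> xz, of "{p}"] excess_bounds(3)[OF \<sigma> xz p(1)] p
        energy_excess[of L \<sigma> x z] by simp
  qed
qed

lemma const_signs: "(\<lambda>_. 1) \<in> signs L" "(\<lambda>_. -1) \<in> signs L"
  by (auto simp: signs_def)

lemma const_syndromes: "(\<lambda>_. 1) \<in> syndromes L"
  by (simp add: syndromes_def const_signs)

lemma energy_vacuum: "energy L (\<lambda>_. -1) (\<lambda>_. 1) (\<lambda>_. 1) = - 2 * sqrt 2 * (real L)\<^sup>2"
  by (simp add: energy_def epsilon_values card_sites)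

text \<open>The sign functions are unconstrained off the lattice, so infinitely many of them occur;
  finiteness follows after restricting the plaquette energies to the sites, where they take finitely
  many values.\<close>

lemma finite_energy_set:
  "finite {energy L \<sigma> x z | \<sigma> x z. \<sigma> \<in> signs L \<and> x \<in> syndromes L \<and> z \<in> syndromes L}" (is "finite ?E")
proof (rule finite_subset)
  define T where "T = (\<lambda>(s, x, z). s * \<epsilon> x z) ` ({1, -1} \<times> {1, -1} \<times> {1, -1})"
  let ?F = "(\<lambda>f. \<Sum>p\<in>sites L. f p) ` (sites L \<rightarrow>\<^sub>E T)"
  have T: "s * \<epsilon> x z \<in> T" if "s \<in> {1, -1}" "x \<in> {1, -1}" "z \<in> {1, -1}" for s x z
    unfolding T_def using that by (intro image_eqI[where x = "(s, x, z)"] SigmaI) simp_all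
  have "finite T" by (simp add: T_def)
  then show "finite ?F"
    by (intro finite_imageI finite_PiE finite_sites)
  show "?E \<subseteq> ?F"
  proof clarify
    fix \<sigma> x z assume "\<sigma> \<in> signs L" "x \<in> syndromes L" "z \<in> syndromes L"
    then have "\<sigma> p * \<epsilon> (x p) (z p) \<in> T" if "p \<in> sites L" for p
      using that T unfolding syndromes_def signs_def Pi_iff by simp
    then have R: "restrict (\<lambda>p. \<sigma> p * \<epsilon> (x p) (z p)) (sites L) \<in> sites L \<rightarrow>\<^sub>E T"
      by (rule restrict_PiE_iff[THEN iffD2, OF ballI])
    have "energy L \<sigma> x z = (\<Sum>p\<in>sites L. restrict (\<lambda>p. \<sigma> p * \<epsilon> (x p) (z p)) (sites L) p)"
      unfolding energy_def by (rule sum.cong) simp_all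
    with R show "energy L \<sigma> x z \<in> ?F" by (intro rev_image_eqI[OF R])
  qed
qed

context torus
begin

section \<open>The spectrum in a sector and on the whole space\<close>

lemma hamiltonian_joint_eigenspace_energy:
  assumes "\<psi> \<in> joint_eigenspace x z s"
  shows "hamiltonian L \<psi> = cscale (of_real (energy L (\<lambda>p. - s p) x z)) \<psi>"
  using hamiltonian_joint_eigenspace[OF assms] by (simp add: energy_def)

lemma subspace_eigenspace_hamiltonian:
  "qstate.subspace V \<Longrightarrow> qstate.subspace (eigenspace V (hamiltonian L) \<mu>)"
  unfolding eigenspace_def by (rule qstate.subspace_eigenspace[OF _ op_linear_hamiltonian])

text \<open>The eigenspace of H inside a sector is stable under every W, so it contains a joint
  eigenvector, whose energy must be \<mu>.\<close>

lemma sector_eigenvalue: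
  assumes "\<psi> \<in> eigenspace (sector L x z) (hamiltonian L) \<mu>" "\<psi> \<noteq> 0"
  obtains \<sigma> where "\<sigma> \<in> signs L" "\<mu> = of_real (energy L \<sigma> x z)"
proof -
  let ?V = "eigenspace (sector L x z) (hamiltonian L) \<mu>"
  have lin: "plaquette_op x z p (cscale c \<phi>) = cscale c (plaquette_op x z p \<phi>)" for p c \<phi>
    unfolding plaquette_op_def by (rule op_linearD(2)[OF op_linear_gauge_op])
  obtain s \<phi> where s: "s \<in> signs L" "\<phi> \<in> ?V" "\<phi> \<in> joint_eigenspace x z s" "\<phi> \<noteq> 0"
    by (rule exists_joint_eigenvector[OF subspace_eigenspace_hamiltonian[OF subspace_sector] _ assms])
       (auto simp: eigenspace_def plaquette_op_sector hamiltonian_plaquette_op lin)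
  have "cscale \<mu> \<phi> = cscale (of_real (energy L (\<lambda>p. - s p) x z)) \<phi>"
    using s hamiltonian_joint_eigenspace_energy by (auto simp: eigenspace_def)
  then have "\<mu> = of_real (energy L (\<lambda>p. - s p) x z)"
    using s(4) qstate.scale_cancel_right by blast
  moreover have "(\<lambda>p. - s p) \<in> signs L"
    using s(1) by (auto simp: signs_def)
  ultimately show ?thesis using that by blast
qed

lemma eigenvector_exists:
  assumes "\<sigma> \<in> signs L" "x \<in> syndromes L" "z \<in> syndromes L"
  obtains \<psi> where "\<psi> \<in> sector L x z" "\<psi> \<noteq> 0"
    "hamiltonian L \<psi> = cscale (of_real (energy L \<sigma> x z)) \<psi>"
proof -
  have "(\<lambda>p. - \<sigma> p) \<in> signs L"
    using assms(1) by (auto simp: signs_def)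
  then obtain \<psi> where \<psi>: "\<psi> \<in> joint_eigenspace x z (\<lambda>p. - \<sigma> p)" "\<psi> \<noteq> 0"
    using joint_eigenspace_nontrivial[OF assms(2,3)] by blast
  show ?thesis
    using that[of \<psi>] \<psi> hamiltonian_joint_eigenspace_energy[OF \<psi>(1)]
    by (simp add: joint_eigenspace_def)
qed

lemma eigenvalues_sector:
  assumes "x \<in> syndromes L" "z \<in> syndromes L"
  shows "eigenvalues (sector L x z) (hamiltonian L) =
    {of_real (energy L \<sigma> x z) | \<sigma>. \<sigma> \<in> signs L}"
proof (intro set_eqI iffI)
  fix \<mu> assume "\<mu> \<in> eigenvalues (sector L x z) (hamiltonian L)"
  then obtain \<psi> where "\<psi> \<in> eigenspace (sector L x z) (hamiltonian L) \<mu>" "\<psi> \<noteq> 0"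
    by (auto simp: eigenvalues_def)
  then show "\<mu> \<in> {of_real (energy L \<sigma> x z) | \<sigma>. \<sigma> \<in> signs L}"
    by (rule sector_eigenvalue) blast
next
  fix \<mu> assume "\<mu> \<in> {complex_of_real (energy L \<sigma> x z) | \<sigma>. \<sigma> \<in> signs L}"
  then obtain \<sigma> where \<sigma>: "\<sigma> \<in> signs L" "\<mu> = of_real (energy L \<sigma> x z)" by blast
  obtain \<psi> where "\<psi> \<in> sector L x z" "\<psi> \<noteq> 0" "hamiltonian L \<psi> = cscale \<mu> \<psi>"
    using eigenvector_exists[OF \<sigma>(1) assms] \<sigma>(2) by blast
  then show "\<mu> \<in> eigenvalues (sector L x z) (hamiltonian L)"
    by (auto simp: eigenvalues_def eigenspace_def)
qed

text \<open>\<open>V\<close> is assumed stable under the stabilizers but not under W: the vector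
  \<phi> stays in \<open>V\<close>, while the joint eigenvector that identifies \<mu> is sought in
  the whole eigenspace of H in the sector.\<close>

lemma hilbert_eigenvalue:
  assumes V: "qstate.subspace V" "V \<subseteq> eigenspace (hilbert L) (hamiltonian L) \<mu>" "\<psi> \<in> V" "\<psi> \<noteq> 0"
    and inv: "\<And>p \<psi>. p \<in> sites L \<Longrightarrow> \<psi> \<in> V \<Longrightarrow> stab_X L p \<psi> \<in> V \<and> stab_Z L p \<psi> \<in> V"
  obtains \<sigma> x z \<phi> where "\<sigma> \<in> signs L" "x \<in> syndromes L" "z \<in> syndromes L"
    "\<phi> \<in> V" "\<phi> \<in> sector L x z" "\<phi> \<noteq> 0" "\<mu> = of_real (energy L \<sigma> x z)"
proof -
  have "V \<subseteq> hilbert L" using V(2) by (auto simp: eigenspace_def)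
  then obtain x z \<phi> where \<phi>: "x \<in> syndromes L" "z \<in> syndromes L" "\<phi> \<in> V" "\<phi> \<in> sector L x z" "\<phi> \<noteq> 0"
    using exists_sector[OF V(1) _ V(3,4) inv] by blast
  then have "\<phi> \<in> eigenspace (sector L x z) (hamiltonian L) \<mu>"
    using V(2) by (auto simp: eigenspace_def)
  then obtain \<sigma> where "\<sigma> \<in> signs L" "\<mu> = of_real (energy L \<sigma> x z)"
    using sector_eigenvalue \<phi>(5) by blast
  then show ?thesis using that \<phi> by blast
qed

lemma eigenspace_stab_invariant:
  assumes "p \<in> sites L" "\<psi> \<in> eigenspace (hilbert L) (hamiltonian L) \<mu>"
  shows "stab_X L p \<psi> \<in> eigenspace (hilbert L) (hamiltonian L) \<mu>"
    "stab_Z L p \<psi> \<in> eigenspace (hilbert L) (hamiltonian L) \<mu>"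
  using assms op_linearD(2)[OF op_linear_stab(1)[OF assms(1)]]
    op_linearD(2)[OF op_linear_stab(2)[OF assms(1)]]
  by (auto simp: eigenspace_def stab_hilbert simp flip: stab_hamiltonian_commute)

lemma eigenvalues_hilbert:
  "eigenvalues (hilbert L) (hamiltonian L) =
    {of_real (energy L \<sigma> x z) | \<sigma> x z. \<sigma> \<in> signs L \<and> x \<in> syndromes L \<and> z \<in> syndromes L}"
  (is "_ = ?R")
proof (intro set_eqI iffI)
  fix \<mu> assume "\<mu> \<in> eigenvalues (hilbert L) (hamiltonian L)"
  then obtain \<psi> where \<psi>: "\<psi> \<in> eigenspace (hilbert L) (hamiltonian L) \<mu>" "\<psi> \<noteq> 0"
    by (auto simp: eigenvalues_def)
  show "\<mu> \<in> ?R"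
    by (rule hilbert_eigenvalue[OF subspace_eigenspace_hamiltonian[OF subspace_hilbert] order.refl \<psi>])
       (use eigenspace_stab_invariant in blast)+
next
  fix \<mu> assume "\<mu> \<in> ?R"
  then obtain \<sigma> x z where \<sigma>: "\<sigma> \<in> signs L" "x \<in> syndromes L" "z \<in> syndromes L"
    "\<mu> = of_real (energy L \<sigma> x z)" by blast
  obtain \<psi> where "\<psi> \<in> sector L x z" "\<psi> \<noteq> 0" "hamiltonian L \<psi> = cscale \<mu> \<psi>"
    using eigenvector_exists[OF \<sigma>(1-3)] \<sigma>(4) by blast
  then show "\<mu> \<in> eigenvalues (hilbert L) (hamiltonian L)"
    by (auto simp: eigenvalues_def eigenspace_def sector_def)
qed

lemma energies_eq:
  "energies L = {energy L \<sigma> x z | \<sigma> x z. \<sigma> \<in> signs L \<and> x \<in> syndromes L \<and> z \<in> syndromes L}"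
  unfolding energies_def eigenvalues_hilbert by auto

lemma finite_energies: "finite (energies L)"
  unfolding energies_eq by (rule finite_energy_set)

section \<open>Ground energy, gap and ground space\<close>

lemma ground_energy_eq: "ground_energy L = - 2 * sqrt 2 * (real L)\<^sup>2"
  unfolding ground_energy_def
proof (rule Min_eqI[OF finite_energies])
  show "- 2 * sqrt 2 * (real L)\<^sup>2 \<le> E" if "E \<in> energies L" for E
    using that energy_ge unfolding energies_eq syndromes_def by auto
  show "- 2 * sqrt 2 * (real L)\<^sup>2 \<in> energies L"
    using energy_vacuum[of L] const_signs[of L] const_syndromes[of L]
    unfolding energies_eq by (metis (mono_tags, lifting) mem_Collect_eq)
qed

lemma energy_eq_ground_energy:
  assumes "\<sigma> \<in> signs L" "x \<in> syndromes L" "z \<in> syndromes L" "energy L \<sigma> x z = ground_energy L"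
    "p \<in> sites L"
  shows "x p \<noteq> -1" "z p \<noteq> -1" "\<sigma> p = -1"
proof -
  have *: "\<not> (\<exists>p\<in>sites L. x p = -1 \<or> z p = -1 \<or> \<sigma> p = 1)"
    using energy_gap_ge[OF assms(1-3)] assms(4) one_less_sqrt_2 unfolding ground_energy_eq by auto
  then show "x p \<noteq> -1" "z p \<noteq> -1" using assms(5) by auto
  show "\<sigma> p = -1"
    using * assms(1,5) by (auto simp: signs_def Pi_iff)
qed

lemma energy_gap_eq: "energy_gap L = 4 * (sqrt 2 - 1)"
proof -
  let ?a = "(0, 0) :: site" and ?b = "(1, 0) :: site"
  let ?E = "- 2 * sqrt 2 * (real L)\<^sup>2 + 4 * (sqrt 2 - 1)"
  have ab: "{?a, ?b} \<subseteq> sites L"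
    using L_ge_2 by (auto simp: sites_def)
  \<comment> \<open>Two X defects at neighbouring plaquettes, distinct because \<open>L\<close> is
    at least 2, with every \<sigma> equal to -1: the cheapest excitation allowed by the parity
    constraint.\<close>
  define x where "x p = (if p \<in> {?a, ?b} then -1 else 1 :: real)" for p
  have "(\<Prod>p\<in>sites L. x p) = (\<Prod>p\<in>{?a, ?b}. x p)"
    using ab by (intro prod.mono_neutral_right finite_sites) (auto simp: x_def)
  then have x: "x \<in> syndromes L"
    by (auto simp: syndromes_def signs_def x_def)
  have "(\<Sum>p\<in>sites L. excess (\<lambda>_. -1) x (\<lambda>_. 1) p) = (\<Sum>p\<in>{?a, ?b}. excess (\<lambda>_. -1) x (\<lambda>_. 1) p)"
    using ab by (intro sum.mono_neutral_right finite_sites) (auto simp: x_def excess_def epsilon_values)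
  then have "energy L (\<lambda>_. -1) x (\<lambda>_. 1) = ?E"
    by (simp add: energy_excess x_def excess_def epsilon_values)
  then have mem: "?E \<in> energies L"
    using x const_signs[of L] const_syndromes[of L] unfolding energies_eq
    by (metis (mono_tags, lifting) mem_Collect_eq)
  have "Min (energies L - {ground_energy L}) = ?E"
  proof (rule Min_eqI)
    show "finite (energies L - {ground_energy L})"
      using finite_energies by simp
    show "?E \<in> energies L - {ground_energy L}"
      using mem one_less_sqrt_2 by (simp add: ground_energy_eq)
    fix E assume "E \<in> energies L - {ground_energy L}"
    then obtain \<sigma> x z where E: "\<sigma> \<in> signs L" "x \<in> syndromes L" "z \<in> syndromes L"
      "E = energy L \<sigma> x z" "E \<noteq> ground_energy L"
      unfolding energies_eq by blast
    have "\<exists>p\<in>sites L. x p = -1 \<or> z p = -1 \<or> \<sigma> p = 1"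
    proof (rule ccontr)
      assume "\<not> ?thesis"
      then have "\<sigma> p = -1 \<and> x p = 1 \<and> z p = 1" if "p \<in> sites L" for p
        using that E(1-3) by (auto simp: syndromes_def signs_def Pi_iff)
      then have "energy L \<sigma> x z = energy L (\<lambda>_. -1) (\<lambda>_. 1) (\<lambda>_. 1)"
        unfolding energy_def by (intro sum.cong) auto
      then show False
        using E(4,5) by (simp add: energy_vacuum ground_energy_eq)
    qed
    then show "?E \<le> E"
      using energy_gap_ge[OF E(1-3)] E(4) by simp
  qed
  then show ?thesis
    by (simp add: energy_gap_def ground_energy_eq)
qed

text \<open>If \<open>S\<close> moved a ground vector \<psi>, then \<open>\<psi> - S \<psi>\<close>
  would be a nonzero ground vector on which \<open>S\<close> is -1. The space of such vectors is
  stable under all stabilizers, so it would contain one in a sector with a defect at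
  \<open>p\<close>, contradicting the gap bound.\<close>

lemma ground_space_stab:
  assumes p: "p \<in> sites L" and S: "S \<in> {stab_X L p, stab_Z L p}" and \<psi>: "\<psi> \<in> ground_space L"
  shows "S \<psi> = \<psi>"
proof (rule ccontr)
  assume "S \<psi> \<noteq> \<psi>"
  have lin: "op_linear S"
    using S op_linear_stab[OF p] by auto
  have inv: "S (S \<phi>) = \<phi>" for \<phi>
    using S stab_involution[OF p] by auto
  have comm: "stab_X L q (S \<phi>) = S (stab_X L q \<phi>)" "stab_Z L q (S \<phi>) = S (stab_Z L q \<phi>)"
    if "q \<in> sites L" for q \<phi>
    using S stab_commute[OF p that] stab_commute[OF that p] by auto
  define V where "V = {\<phi> \<in> ground_space L. S \<phi> = cscale (- 1) \<phi>}"
  have sub: "qstate.subspace (ground_space L)"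
    unfolding ground_space_def by (intro subspace_eigenspace_hamiltonian subspace_hilbert)
  have V: "qstate.subspace V" "V \<subseteq> eigenspace (hilbert L) (hamiltonian L) (of_real (ground_energy L))"
    using qstate.subspace_eigenspace[OF sub lin, of "- 1"] unfolding V_def ground_space_def by auto
  have "S \<psi> \<in> ground_space L"
    using \<psi> S eigenspace_stab_invariant[OF p] unfolding ground_space_def by auto
  then have mem: "\<psi> - S \<psi> \<in> V"
    using \<psi> sub by (simp add: V_def qstate.subspace_diff op_linearD[OF lin] inv)
  have nonzero: "\<psi> - S \<psi> \<noteq> 0" using \<open>S \<psi> \<noteq> \<psi>\<close> by auto
  have "stab_X L q \<phi> \<in> V \<and> stab_Z L q \<phi> \<in> V" if "q \<in> sites L" "\<phi> \<in> V" for q \<phi>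
    using that eigenspace_stab_invariant[OF that(1)] comm[OF that(1), of \<phi>]
      op_linearD(4)[OF op_linear_stab(1)[OF that(1)]] op_linearD(4)[OF op_linear_stab(2)[OF that(1)]]
    by (simp add: V_def ground_space_def)
  then obtain \<sigma> x z \<phi> where \<phi>: "\<sigma> \<in> signs L" "x \<in> syndromes L" "z \<in> syndromes L"
    "\<phi> \<in> V" "\<phi> \<in> sector L x z" "\<phi> \<noteq> 0"
    "complex_of_real (ground_energy L) = of_real (energy L \<sigma> x z)"
    using hilbert_eigenvalue[OF V mem nonzero] by blast
  have "S \<phi> = cscale (of_real (x p)) \<phi> \<or> S \<phi> = cscale (of_real (z p)) \<phi>"
    using \<phi>(5) S p by (auto simp: sector_def)
  moreover have "S \<phi> = cscale (of_real (- 1)) \<phi>"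
    using \<phi>(4) by (simp add: V_def)
  ultimately have "x p = -1 \<or> z p = -1"
    using \<phi>(6) by (metis qstate.scale_cancel_right of_real_eq_iff)
  moreover have "energy L \<sigma> x z = ground_energy L"
    using \<phi>(7) by simp
  ultimately show False
    using energy_eq_ground_energy(1,2)[OF \<phi>(1-3) _ p] by blast
qed

lemma ground_space_subset_sector: "ground_space L \<subseteq> sector L (\<lambda>_. 1) (\<lambda>_. 1)"
  using ground_space_stab unfolding sector_def
  by (auto simp: ground_space_def eigenspace_def)

text \<open>The argument by the -1 part is repeated for W, now inside the sector without defects: a
  ground vector moved by W would yield a joint eigenvector with W equal to -1 at \<open>p\<close>,
  and its energy lies above the ground energy. The equality transfers the dimension count to the
  ground space.\<close>

lemma ground_space_eq: "ground_space L = joint_eigenspace (\<lambda>_. 1) (\<lambda>_. 1) (\<lambda>_. 1)"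
proof (intro subset_antisym subsetI)
  let ?W = "plaquette_op (\<lambda>_. 1) (\<lambda>_. 1)"
  fix \<psi> assume \<psi>: "\<psi> \<in> ground_space L"
  then have sec: "\<psi> \<in> sector L (\<lambda>_. 1) (\<lambda>_. 1)"
    using ground_space_subset_sector by blast
  have "?W p \<psi> = \<psi>" if p: "p \<in> sites L" for p
  proof (rule ccontr)
    assume "?W p \<psi> \<noteq> \<psi>"
    have lin: "op_linear (?W q)" for q
      unfolding plaquette_op_def by (rule op_linear_gauge_op)
    have inv: "?W p (?W p \<phi>) = \<phi>" for \<phi>
      using gauge_op_involution[OF p plaquette_op_square] unfolding plaquette_op_def by simp
    have comm: "?W q (?W p \<phi>) = ?W p (?W q \<phi>)" if "q \<in> sites L" for q \<phi>
      using gauge_op_commute[OF that p] unfolding plaquette_op_def by (cases "q = p") auto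
    let ?G = "eigenspace (sector L (\<lambda>_. 1) (\<lambda>_. 1)) (hamiltonian L) (of_real (ground_energy L))"
    define V where "V = {\<phi> \<in> ?G. ?W p \<phi> = cscale (- 1) \<phi>}"
    have sub: "qstate.subspace ?G"
      by (intro subspace_eigenspace_hamiltonian subspace_sector)
    have WG: "?W q \<phi> \<in> ?G" if "q \<in> sites L" "\<phi> \<in> ?G" for q \<phi>
      using that by (simp add: eigenspace_def plaquette_op_sector hamiltonian_plaquette_op
          op_linearD[OF lin])
    have V: "qstate.subspace V" "V \<subseteq> sector L (\<lambda>_. 1) (\<lambda>_. 1)"
      using qstate.subspace_eigenspace[OF sub lin[of p], of "- 1"] unfolding V_def by (auto simp: eigenspace_def)
    have G: "\<psi> \<in> ?G"
      using \<psi> sec by (simp add: ground_space_def eigenspace_def)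
    then have "\<psi> - ?W p \<psi> \<in> V"
      using sub WG[OF p G] by (simp add: V_def qstate.subspace_diff op_linearD[OF lin] inv)
    moreover have "\<psi> - ?W p \<psi> \<noteq> 0" using \<open>?W p \<psi> \<noteq> \<psi>\<close> by auto
    moreover have "?W q \<phi> \<in> V" if "q \<in> sites L" "\<phi> \<in> V" for q \<phi>
      using that WG comm[OF that(1), of \<phi>, symmetric] by (simp add: V_def op_linearD[OF lin])
    ultimately obtain s \<phi> where \<phi>: "s \<in> signs L" "\<phi> \<in> V" "\<phi> \<in> joint_eigenspace (\<lambda>_. 1) (\<lambda>_. 1) s" "\<phi> \<noteq> 0"
      using exists_joint_eigenvector[OF V] by blast
    have "cscale (of_real (ground_energy L)) \<phi> =
        cscale (of_real (energy L (\<lambda>p. - s p) (\<lambda>_. 1) (\<lambda>_. 1))) \<phi>"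
      using \<phi>(2) hamiltonian_joint_eigenspace_energy[OF \<phi>(3)] by (auto simp: V_def eigenspace_def)
    then have "energy L (\<lambda>p. - s p) (\<lambda>_. 1) (\<lambda>_. 1) = ground_energy L"
      using \<phi>(4) by (metis qstate.scale_cancel_right of_real_eq_iff)
    moreover have "(\<lambda>p. - s p) \<in> signs L"
      using \<phi>(1) by (auto simp: signs_def)
    ultimately have "s p = 1"
      using energy_eq_ground_energy(3)[OF _ const_syndromes const_syndromes _ p] by force
    moreover have "cscale (of_real (s p)) \<phi> = cscale (of_real (- 1)) \<phi>"
      using \<phi>(2,3) p by (simp add: V_def joint_eigenspace_def)
    ultimately show False
      using \<phi>(4) by (metis qstate.scale_cancel_right of_real_eq_iff one_neq_neg_one)
  qed
  then show "\<psi> \<in> joint_eigenspace (\<lambda>_. 1) (\<lambda>_. 1) (\<lambda>_. 1)"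
    using sec by (simp add: joint_eigenspace_def)
next
  fix \<psi> assume \<psi>: "\<psi> \<in> joint_eigenspace (\<lambda>_. 1) (\<lambda>_. 1) (\<lambda>_. 1)"
  then have "hamiltonian L \<psi> = cscale (of_real (ground_energy L)) \<psi>"
    using hamiltonian_joint_eigenspace_energy[OF \<psi>] by (simp add: energy_vacuum ground_energy_eq)
  then show "\<psi> \<in> ground_space L"
    using \<psi> by (simp add: ground_space_def eigenspace_def joint_eigenspace_def sector_def)
qed

end

theorem mainTheorem2:
  fixes L :: nat
  assumes "L \<ge> 2"
  shows
    "eigenvalues (hilbert L) (hamiltonian L) =
       {complex_of_real (\<Sum>p\<in>plaquettes L. \<sigma> p * \<epsilon> (x p) (z p)) | \<sigma> x z.
          \<sigma> \<in> signs L \<and> x \<in> syndromes L \<and> z \<in> syndromes L}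
     \<and> (\<forall>x\<in>syndromes L. \<forall>z\<in>syndromes L.
          eigenvalues (sector L x z) (hamiltonian L) =
            {complex_of_real (\<Sum>p\<in>plaquettes L. \<sigma> p * \<epsilon> (x p) (z p)) | \<sigma>. \<sigma> \<in> signs L})
     \<and> \<epsilon> 1 1 = 2 * sqrt 2 \<and> \<epsilon> 1 (- 1) = 2 \<and> \<epsilon> (- 1) 1 = 2 \<and> \<epsilon> (- 1) (- 1) = 0
     \<and> ground_energy L = - 2 * sqrt 2 * (real L)\<^sup>2
     \<and> ground_space L \<subseteq> sector L (\<lambda>_. 1) (\<lambda>_. 1)
     \<and> qstate.dim (ground_space L) = 4
     \<and> energy_gap L = 4 * (sqrt 2 - 1)"
proof -
  interpret torus L using assms by unfold_locales
  have "qstate.dim (ground_space L) = 4"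
    unfolding ground_space_eq by (intro dim_joint_eigenspace const_syndromes const_signs)
  then show ?thesis
    using eigenvalues_hilbert eigenvalues_sector epsilon_values ground_energy_eq
      ground_space_subset_sector energy_gap_eq
    unfolding energy_def by simp
qed

end
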